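(* Let $X=(X_t)_{t\ge 0}$ be a real Lévy process with characteristics $(a,0,\nu)$ and index $\beta$. Let $p\in(0,\infty)$ be such that $\mathbb{E}\,|X_1|^p<+\infty$ and such that either - $p\in(\beta,\infty)$, or - $p=\beta$, $\beta>0$ and $\int_{\{|x|\le 1\}}|x|^\beta\,d\nu(x)<+\infty$. Then there is a finite real constant $C_p$ such that for every $t\ge 0$ $$\mathbb{E}\,\sup_{s\le t}|Y_s|^p\le C_p\,t\qquad\text{if } p<1,$$ $$\mathbb{E}\,\sup_{s\le t}|X_s-s\,\mathbb{E}X_1|^p\le C_p\,t\qquad\text{if } 1\le p\le 2,$$ where $Y_t=X_t-t\left(a-\int_{\{|x|\le 1\}}x\,d\nu(x)\right)$. Furthermore, if $p>2$, then $$\mathbb{E}\,\sup_{s\le t}|X_s|^p=O(t)\qquad\text{as } t\to 0.$$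
   Context: A (càdlàg) real Lévy process $X=(X_t)_{t\ge0}$ has characteristics $(a,\sigma^2,\nu)$ if $\mathbb{E}\,e^{iuX_t}=e^{-t\Psi(u)}$ for all $u\in\mathbb{R}$, $t\ge 0$, with $$\Psi(u)=-iua+\tfrac12\sigma^2u^2-\int\left(e^{iux}-1-iux\mathbf{1}_{\{|x|\le1\}}\right)d\nu(x),$$ where $a\in\mathbb{R}$, $\sigma^2\ge0$, and $\nu$ (the Lévy measure) is a measure on $\mathbb{R}$ with $\nu(\{0\})=0$ and $\int (x^2\wedge1)\,d\nu(x)<+\infty$. Characteristics $(a,0,\nu)$ means $\sigma^2=0$, i.e. $X$ has no Brownian component. The index of $X$ is $\beta=\inf\{p>0:\int_{\{|x|\le1\}}|x|^p\,d\nu(x)<+\infty\}\in[0,2]$. The suprema $\sup_{s\le t}$ are over $s\in[0,t]$. The process $Y$ is only used when $p<1$, in which case $\int_{\{|x|\le1\}}|x|\,d\nu(x)<+\infty$. The constants $C_p$ and the implied constant in $O(t)$ may depend on $p$ and on the law of $X$, but not on $t$. *)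

theory Defs
  imports "HOL-Probability.Probability" "HOL-Library.Landau_Symbols"
begin

definition cadlag :: "(real \<Rightarrow> real) \<Rightarrow> bool" where
  "cadlag f \<longleftrightarrow>
     (\<forall>t\<ge>0. (f \<longlongrightarrow> f t) (at_right t)) \<and>
     (\<forall>t>0. \<exists>l. (f \<longlongrightarrow> l) (at_left t))"

(* The time parameter is a real; only the values X t with t >= 0 are relevant. *)
locale levy_process = prob_space M
  for M :: "'a measure" and X :: "real \<Rightarrow> 'a \<Rightarrow> real" +
  assumes rv: "\<And>t. 0 \<le> t \<Longrightarrow> random_variable borel (X t)"
    and start_zero: "AE \<omega> in M. X 0 \<omega> = 0"
    and indep_increments:
      "\<And>(n::nat) (t::nat \<Rightarrow> real). \<lbrakk>0 \<le> t 0; \<And>i. i < n \<Longrightarrow> t i < t (Suc i)\<rbrakk> \<Longrightarrow>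
         indep_vars (\<lambda>_. borel) (\<lambda>i \<omega>. X (t (Suc i)) \<omega> - X (t i) \<omega>) {..<n}"
    and stationary_increments:
      "\<And>s t. \<lbrakk>0 \<le> s; 0 \<le> t\<rbrakk> \<Longrightarrow>
         distr M borel (\<lambda>\<omega>. X (s + t) \<omega> - X s \<omega>) = distr M borel (X t)"
    and cadlag_paths: "AE \<omega> in M. cadlag (\<lambda>t. X t \<omega>)"

definition levy_measure :: "real measure \<Rightarrow> bool" where
  "levy_measure \<nu> \<longleftrightarrow>
     sets \<nu> = sets borel \<and> emeasure \<nu> {0} = 0 \<and>
     (\<integral>\<^sup>+x. ennreal (min (x\<^sup>2) 1) \<partial>\<nu>) < \<infinity>"

(* The argument s2 is the variance sigma^2 of the Gaussian part, not sigma. *)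
definition levy_exponent :: "real \<Rightarrow> real \<Rightarrow> real measure \<Rightarrow> real \<Rightarrow> complex" where
  "levy_exponent a s2 \<nu> u =
     - \<i> * of_real (u * a) + of_real (s2 * u\<^sup>2 / 2)
     - (CLINT x|\<nu>. iexp (u * x) - 1 - \<i> * of_real (u * x * indicator {x. \<bar>x\<bar> \<le> 1} x))"

definition has_characteristics ::
    "'a measure \<Rightarrow> (real \<Rightarrow> 'a \<Rightarrow> real) \<Rightarrow> real \<Rightarrow> real \<Rightarrow> real measure \<Rightarrow> bool" where
  "has_characteristics M X a s2 \<nu> \<longleftrightarrow>
     0 \<le> s2 \<and> levy_measure \<nu> \<and>
     (\<forall>u. \<forall>t\<ge>0. char (distr M borel (X t)) u = exp (- of_real t * levy_exponent a s2 \<nu> u))"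

definition small_jump_moment :: "real measure \<Rightarrow> real \<Rightarrow> ennreal" where
  "small_jump_moment \<nu> p = (\<integral>\<^sup>+x\<in>{x. \<bar>x\<bar> \<le> 1}. ennreal (\<bar>x\<bar> powr p) \<partial>\<nu>)"

(* For a Levy measure the set contains 2 and is bounded below by 0, so Inf is the true infimum. *)
definition levy_index :: "real measure \<Rightarrow> real" where
  "levy_index \<nu> = Inf {p. 0 < p \<and> small_jump_moment \<nu> p < \<infinity>}"

(* E sup_{s <= t} |Z_s|^p, as an extended nonnegative real so that finiteness is not presupposed. *)
definition sup_moment ::
    "'a measure \<Rightarrow> (real \<Rightarrow> 'a \<Rightarrow> real) \<Rightarrow> real \<Rightarrow> real \<Rightarrow> ennreal" where
  "sup_moment M Z p t = (\<integral>\<^sup>+\<omega>. (SUP s\<in>{0..t}. ennreal (\<bar>Z s \<omega>\<bar> powr p)) \<partial>M)"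

end

theory Submission
  imports Defs
begin

text \<open>
  Everything reduces to an estimate for the law at a single time: for the correctly centred process $Z$ one
  shows $E|Z_t|^p \<le> C t$, for all $t$ if $p \<le> 2$ and for $t \<le> 1$ if $p > 2$. Increments over a grid of
  mesh $h$ are independent copies of $Z_h$, so the grid supremum is controlled by maximal inequalities for random walks; the bound does not
  depend on the mesh, and right-continuity of the paths together with monotone convergence along dyadic
  grids turns it into a bound for the full supremum.

  For $0 < p < 2$ the marginal estimate is Fourier analytic. For a probability measure $\mu$,
  $K_p \int |x|^p d\mu = \int_0^\infty (1 - Re \hat\mu(u)) u^{-1-p} du$ (\<open>mellin_one_minus_Re_char\<close>), and the
  same scaling identity with $\nu$ in place of $\mu$ expresses $\int |x|^p d\nu$ by the real part
  $R(u) = \int (1 - \cos ux) d\nu$ of the characteristic exponent. Since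
  $1 - Re \hat\mu_1 \<ge> 1 - e^{-R} \<ge> c R$ near $0$, finiteness of $E|X_1|^p$ forces
  $\int_{|x|>1} |x|^p d\nu < \infty$ (\<open>large_jump_moment_finite\<close>); the condition on the index takes care of the small
  jumps. In the other direction, if $p < 1$, then $1 - Re \hat\mu_t \<le> t (R + |I|)$ for the driftless process,
  where $I$ is the imaginary part of its exponent, and $R + |I|$ is at most the integral of
  $3 \min(1, |ux|)$ against $\nu$ (\<open>moment_bound_of_driftless_char\<close>). If $1 \<le> p < 2$, the drift is removed by symmetrisation:
  $X_t - X'_t$, with an independent copy $X'$, has characteristic function $e^{-2tR} \<ge> 1 - 2tR$
  (\<open>moment_bound_of_symmetrized_char\<close>), and by Jensen's inequality the centred moment of $X_t$ is at most the
  moment of $X_t - X'_t$ (\<open>centered_moment_le_symmetrize\<close>).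

  For $p \<ge> 2$ the moments $m_t$ of the symmetrised laws satisfy $m_{s+t} \<ge> m_s + m_t$, by Clarkson's inequality
  averaged over the sign of a symmetric summand, and equality holds for $p = 2$. As $m_1$ is finite,
  $m_t \<le> 2 m_1 t$ for $t \<le> 1$, and for all $t$ if $p = 2$ (\<open>symmetrized_moment_bound_ge_two\<close>).

  The maximal inequality for $p \<le> 1$ is subadditivity of $|x|^p$, and for $p > 1$ it is Doob's $L^p$ inequality
  (\<open>doob_maximal_inequality\<close>). The latter needs the centring $t E X_1$ to be exactly $E X_t$; additivity of $t \<mapsto> E X_t$,
  Fatou's lemma and right-continuity at $0$ give this (\<open>expectation_linear\<close>). For $p > 2$ the drift contributes
  $O(t^p)$, which is $O(t)$ as $t \<rightarrow> 0$.
\<close>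

section \<open>Moments as Mellin transforms\<close>

definition moment :: "real measure \<Rightarrow> real \<Rightarrow> ennreal" where
  "moment \<mu> p = (\<integral>\<^sup>+x. ennreal (\<bar>x\<bar> powr p) \<partial>\<mu>)"

text \<open>
  The Mellin transform of $g$ at $-p$.
\<close>
definition mellin :: "(real \<Rightarrow> ennreal) \<Rightarrow> real \<Rightarrow> ennreal" where
  "mellin g p = (\<integral>\<^sup>+u. g u * (ennreal (u powr (-1-p)) * indicator {0<..} u) \<partial>lborel)"

lemma mellin_mono: "(\<And>u. 0 < u \<Longrightarrow> g u \<le> h u) \<Longrightarrow> mellin g p \<le> mellin h p"
  unfolding mellin_def by (intro nn_integral_mono) (auto intro!: mult_right_mono split: split_indicator)

lemma mellin_cmult:
  assumes [measurable]: "g \<in> borel_measurable borel"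
  shows "mellin (\<lambda>u. c * g u) p = c * mellin g p"
  unfolding mellin_def by (subst nn_integral_cmult[symmetric]) (auto simp: mult.assoc)

text \<open>
  Substituting $v = u |y|$; this homogeneity of degree $p$ is the source of all moment formulas below. The
  condition at $0$ makes the identity hold for $y = 0$, where both sides vanish.
\<close>
lemma mellin_scale:
  assumes [measurable]: "g \<in> borel_measurable borel" and g0: "g 0 = 0"
  shows "mellin (\<lambda>u. g (u * \<bar>y\<bar>)) p = mellin g p * ennreal (\<bar>y\<bar> powr p)"
proof (cases "y = 0")
  case True
  then show ?thesis by (simp add: mellin_def g0)
next
  case False
  define c where "c = \<bar>y\<bar>"
  have c: "c > 0" using False by (simp add: c_def)
  have "mellin g p = ennreal c *
      (\<integral>\<^sup>+u. g (c * u) * (ennreal ((c * u) powr (-1-p)) * indicator {0<..} (c * u)) \<partial>lborel)"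
    unfolding mellin_def using c by (subst nn_integral_real_affine[where c=c and t=0]) auto
  also have "\<dots> = ennreal c *
      (\<integral>\<^sup>+u. ennreal (c powr (-1-p)) * (g (u * c) * (ennreal (u powr (-1-p)) * indicator {0<..} u)) \<partial>lborel)"
  proof (rule arg_cong2[where f="(*)", OF refl], rule nn_integral_cong)
    fix u :: real
    show "g (c * u) * (ennreal ((c * u) powr (-1-p)) * indicator {0<..} (c * u)) =
      ennreal (c powr (-1-p)) * (g (u * c) * (ennreal (u powr (-1-p)) * indicator {0<..} u))"
    proof (cases "0 < u")
      case True
      then have "ennreal ((c * u) powr (-1-p)) = ennreal (c powr (-1-p)) * ennreal (u powr (-1-p))"
        using c by (simp add: powr_mult ennreal_mult)
      then show ?thesis using True c by (simp add: mult_ac)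
    qed (use c in \<open>simp add: zero_less_mult_iff\<close>)
  qed
  also have "\<dots> = ennreal c * (ennreal (c powr (-1-p)) * mellin (\<lambda>u. g (u * c)) p)"
    unfolding mellin_def by (subst nn_integral_cmult) auto
  also have "\<dots> = ennreal (c powr (-p)) * mellin (\<lambda>u. g (u * c)) p"
    using c by (simp add: mult.assoc[symmetric] ennreal_mult[symmetric] powr_mult_base)
  finally have "mellin g p * ennreal (c powr p) =
      (ennreal (c powr p) * ennreal (c powr (-p))) * mellin (\<lambda>u. g (u * c)) p"
    by (simp add: ac_simps)
  also have "ennreal (c powr p) * ennreal (c powr (-p)) = 1"
    using c by (simp add: ennreal_mult[symmetric] powr_add[symmetric])
  finally show ?thesis by (simp add: c_def)
qed

text \<open>
  Tonelli's theorem combined with homogeneity: integrating the dilates of a fixed profile $g$ against $\mu$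
  produces the $p$-th moment of $\mu$. The weight allows the integral to be restricted to large or small $x$.
\<close>
lemma mellin_of_weighted_integral:
  assumes "sigma_finite_measure \<mu>" and [measurable_cong]: "sets \<mu> = sets borel"
    and [measurable]: "g \<in> borel_measurable borel" "w \<in> borel_measurable borel" and g0: "g 0 = 0"
  shows "mellin (\<lambda>u. \<integral>\<^sup>+x. w x * g (u * \<bar>x\<bar>) \<partial>\<mu>) p
      = mellin g p * (\<integral>\<^sup>+x. w x * ennreal (\<bar>x\<bar> powr p) \<partial>\<mu>)"
proof -
  interpret \<mu>: sigma_finite_measure \<mu> by fact
  interpret pair_sigma_finite lborel \<mu> ..
  have "mellin (\<lambda>u. \<integral>\<^sup>+x. w x * g (u * \<bar>x\<bar>) \<partial>\<mu>) p =
      (\<integral>\<^sup>+u. \<integral>\<^sup>+x. w x * (g (u * \<bar>x\<bar>) * (ennreal (u powr (-1-p)) * indicator {0<..} u)) \<partial>\<mu> \<partial>lborel)"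
    unfolding mellin_def by (intro nn_integral_cong) (simp add: nn_integral_multc[symmetric] mult.assoc)
  also have "\<dots> = (\<integral>\<^sup>+x. w x * mellin (\<lambda>u. g (u * \<bar>x\<bar>)) p \<partial>\<mu>)"
    unfolding mellin_def by (subst Fubini'[symmetric]) (auto simp: nn_integral_cmult intro!: nn_integral_cong)
  also have "\<dots> = mellin g p * (\<integral>\<^sup>+x. w x * ennreal (\<bar>x\<bar> powr p) \<partial>\<mu>)"
    by (subst nn_integral_cmult[symmetric]) (auto simp: mellin_scale g0 ac_simps)
  finally show ?thesis .
qed

lemma mellin_of_integral:
  assumes "sigma_finite_measure \<mu>" "sets \<mu> = sets borel" "g \<in> borel_measurable borel" "g 0 = 0"
  shows "mellin (\<lambda>u. \<integral>\<^sup>+x. g (u * \<bar>x\<bar>) \<partial>\<mu>) p = mellin g p * moment \<mu> p"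
  using mellin_of_weighted_integral[OF assms(1-3), of "\<lambda>_. 1"] assms(4) by (simp add: moment_def)

text \<open>
  Decay like $u^s$ with $s > p$ at the origin and growth at most like $u^r$ with $r < p$ at infinity balance the
  weight $u^{-1-p}$ at both ends.
\<close>
lemma mellin_finite:
  assumes rs: "r < p" "p < s" and g: "\<And>u. 0 < u \<Longrightarrow> g u \<le> ennreal (C * min (u powr r) (u powr s))"
    and C: "0 \<le> C"
  shows "mellin g p < \<infinity>"
proof -
  have pos: "\<And>x::real. 0 \<le> x powr b" for b by simp
  have "mellin g p \<le> (\<integral>\<^sup>+u. ennreal C * (ennreal (u powr (s-1-p)) * indicator {0..1} u
      + ennreal (u powr (r-1-p)) * indicator {1..} u) \<partial>lborel)"
    unfolding mellin_def
  proof (intro nn_integral_mono)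
    fix u :: real
    show "g u * (ennreal (u powr (-1-p)) * indicator {0<..} u) \<le>
      ennreal C * (ennreal (u powr (s-1-p)) * indicator {0..1} u + ennreal (u powr (r-1-p)) * indicator {1..} u)"
    proof (cases "u > 0")
      case u: True
      have *: "g u * ennreal (u powr (-1-p)) \<le> ennreal C * ennreal (u powr (q-1-p))" if "q = r \<or> q = s" for q
      proof -
        have "g u * ennreal (u powr (-1-p)) \<le> ennreal (C * (u powr q)) * ennreal (u powr (-1-p))"
          using that by (intro mult_right_mono order_trans[OF g[OF u]] ennreal_leI mult_left_mono C) auto
        also have "\<dots> = ennreal C * ennreal (u powr (q-1-p))"
        proof -
          have "u powr q * u powr (-1-p) = u powr (q-1-p)"
            by (simp add: powr_add[symmetric] algebra_simps)
          then show ?thesis using C by (simp add: ennreal_mult[symmetric] mult.assoc)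
        qed
        finally show ?thesis .
      qed
      show ?thesis
      proof (cases "u \<le> 1")
        case True
        have "ennreal C * ennreal (u powr (s-1-p)) \<le> ennreal C *
          (ennreal (u powr (s-1-p)) * indicator {0..1} u + ennreal (u powr (r-1-p)) * indicator {1..} u)"
          using True u by (intro mult_left_mono) auto
        with *[of s] u show ?thesis by simp
      next
        case False
        then show ?thesis using *[of r] u by simp
      qed
    qed auto
  qed
  also have "\<dots> = ennreal C * ((\<integral>\<^sup>+u. ennreal (u powr (s-1-p)) * indicator {0..1} u \<partial>lborel)
      + (\<integral>\<^sup>+u. ennreal (u powr (r-1-p)) * indicator {1..} u \<partial>lborel))"
    by (subst nn_integral_cmult) (auto simp: nn_integral_add)
  also have "(\<integral>\<^sup>+u. ennreal (u powr (s-1-p)) * indicator {0..1} u \<partial>lborel) = ennreal (1 / (s - p))"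
    using nn_integral_has_integral_lebesgue'[OF pos has_integral_powr_from_0[of "s-1-p" 1]] rs by simp
  also have "(\<integral>\<^sup>+u. ennreal (u powr (r-1-p)) * indicator {1..} u \<partial>lborel) = ennreal (- 1 / (r - p))"
    using nn_integral_has_integral_lebesgue'[OF pos has_integral_powr_to_inf[of "r-1-p" 1]] rs by simp
  also have "ennreal C * (ennreal (1 / (s - p)) + ennreal (- 1 / (r - p))) < \<infinity>"
    by (simp add: ennreal_mult_less_top)
  finally show ?thesis .
qed

lemma mellin_pos:
  assumes [measurable]: "g \<in> borel_measurable borel" and g: "\<And>u. 0 < u \<Longrightarrow> u < 1 \<Longrightarrow> 0 < g u"
  shows "0 < mellin g p"
proof (rule ccontr)
  assume "\<not> 0 < mellin g p"
  then have "AE u in lborel. g u * (ennreal (u powr (-1-p)) * indicator {0<..} u) = 0"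
    unfolding mellin_def by (subst (asm) zero_less_iff_neq_zero) (simp add: nn_integral_0_iff_AE)
  then have "AE u in lborel. (u::real) \<notin> {0<..<1}"
    by eventually_elim (use g in \<open>auto simp: zero_less_iff_neq_zero split: split_indicator_asm\<close>)
  then have "emeasure lborel {0<..<1::real} = 0"
    by (subst (asm) AE_iff_measurable[of "{0<..<1}"]) auto
  then show False by simp
qed

lemma one_minus_cos_le_square: "1 - cos v \<le> v\<^sup>2 / 2" for v :: real
proof -
  have "1 - cos v = 2 * (sin (v / 2))\<^sup>2" using cos_double_sin[of "v/2"] by simp
  also have "(sin (v / 2))\<^sup>2 \<le> (v / 2)\<^sup>2"
    using abs_sin_x_le_abs_x[of "v/2"] by (simp only: abs_le_square_iff)
  finally show ?thesis by (simp add: power2_eq_square)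
qed

lemma one_minus_cos_le_min: "1 - cos v \<le> 2 * min (v powr 0) (v powr 2)" if "0 < (v::real)"
proof -
  have "1 - cos v \<le> 2 * 1" "1 - cos v \<le> 2 * v\<^sup>2"
    using one_minus_cos_le_square[of v] cos_ge_minus_one[of v] zero_le_power2[of v] by linarith+
  then show ?thesis using that by (simp add: min_def)
qed

lemma one_minus_cos_pos: "0 < 1 - cos v" if "0 < v" "v < (1::real)"
proof -
  have "cos v < cos 0" using that pi_gt3 by (intro cos_monotone_0_pi) auto
  then show ?thesis by simp
qed

lemma mellin_one_minus_cos_finite:
  assumes "0 < p" "p < 2"
  shows "mellin (\<lambda>v. ennreal (1 - cos v)) p < \<infinity>"
  using assms by (intro mellin_finite[where r=0 and s=2 and C=2] ennreal_leI one_minus_cos_le_min) auto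

lemma mellin_one_minus_cos_pos: "0 < mellin (\<lambda>v. ennreal (1 - cos v)) p"
proof (rule mellin_pos)
  show "0 < ennreal (1 - cos u)" if "0 < u" "u < 1" for u
    using one_minus_cos_pos[OF that] by (simp only: ennreal_less_zero_iff)
qed measurable

lemma one_minus_Re_char:
  assumes "real_distribution \<mu>"
  shows "ennreal (1 - Re (char \<mu> u)) = (\<integral>\<^sup>+x. ennreal (1 - cos (u * \<bar>x\<bar>)) \<partial>\<mu>)"
proof -
  interpret real_distribution \<mu> by fact
  have i: "integrable \<mu> (\<lambda>x. iexp (u * x))" by (intro integrable_iexp) auto
  have ic: "integrable \<mu> (\<lambda>x. cos (u * x))" using integrable_Re[OF i] by (simp add: Re_exp)
  have "Re (char \<mu> u) = (LINT x|\<mu>. cos (u * x))"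
    unfolding char_def using i by (subst integral_Re[symmetric]) (auto simp: Re_exp)
  then have "1 - Re (char \<mu> u) = (LINT x|\<mu>. 1 - cos (u * x))"
    using ic prob_space by (simp del: space_eq_univ)
  moreover have "cos (u * \<bar>x\<bar>) = cos (u * x)" for x by (cases "0 \<le> x") auto
  ultimately show ?thesis using ic by (simp add: nn_integral_eq_integral)
qed

text \<open>
  The classical formula for absolute moments of order below two in terms of the characteristic function. The
  constant is finite exactly for $0 < p < 2$.
\<close>
lemma mellin_one_minus_Re_char:
  assumes "real_distribution \<mu>"
  shows "mellin (\<lambda>u. ennreal (1 - Re (char \<mu> u))) p = mellin (\<lambda>v. ennreal (1 - cos v)) p * moment \<mu> p"
proof -
  interpret real_distribution \<mu> by fact
  show ?thesis unfolding one_minus_Re_char[OF assms]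
    by (rule mellin_of_integral[where g="\<lambda>v. ennreal (1 - cos v)"]) (auto intro: sigma_finite_measure)
qed

text \<open>
  The mechanism that turns a bound on the characteristic function, linear in $t$, into a bound on the moment,
  linear in $t$: apply the moment formula to $\mu$ on the left and to $\nu$ on the right, and divide by the finite
  positive constant of the former.
\<close>
lemma moment_le_of_char:
  assumes p: "0 < p" "p < 2" and \<nu>: "sigma_finite_measure \<nu>" "sets \<nu> = sets borel"
    and g: "g \<in> borel_measurable borel" "g 0 = 0" "mellin g p < \<infinity>" and m: "moment \<nu> p < \<infinity>"
  shows "\<exists>C\<ge>0. \<forall>t\<ge>0. \<forall>\<mu>. real_distribution \<mu> \<longrightarrow>
    (\<forall>u>0. ennreal (1 - Re (char \<mu> u)) \<le> ennreal t * (\<integral>\<^sup>+x. g (u * \<bar>x\<bar>) \<partial>\<nu>)) \<longrightarrow>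
    moment \<mu> p \<le> ennreal (C * t)"
proof -
  interpret \<nu>: sigma_finite_measure \<nu> by fact
  note [measurable_cong] = \<nu>(2)
  note [measurable] = g(1)
  define K where "K = mellin (\<lambda>v. ennreal (1 - cos v)) p"
  have K: "K \<noteq> 0" "K \<noteq> \<infinity>"
    using mellin_one_minus_cos_finite[OF p] mellin_one_minus_cos_pos[of p] by (auto simp: K_def)
  have "mellin g p * moment \<nu> p / K \<noteq> \<infinity>"
    using K g(3) m by (auto simp: ennreal_divide_eq_top_iff ennreal_mult_eq_top_iff)
  then obtain C where C: "0 \<le> C" "mellin g p * moment \<nu> p / K = ennreal C"
    by (cases "mellin g p * moment \<nu> p / K") auto
  have "moment \<mu> p \<le> ennreal (C * t)"
    if t: "0 \<le> t" and \<mu>: "real_distribution \<mu>"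
      and le: "\<forall>u>0. ennreal (1 - Re (char \<mu> u)) \<le> ennreal t * (\<integral>\<^sup>+x. g (u * \<bar>x\<bar>) \<partial>\<nu>)" for t \<mu>
  proof -
    have "K * moment \<mu> p \<le> mellin (\<lambda>u. ennreal t * (\<integral>\<^sup>+x. g (u * \<bar>x\<bar>) \<partial>\<nu>)) p"
      unfolding K_def mellin_one_minus_Re_char[OF \<mu>, symmetric] using le by (intro mellin_mono) auto
    also have "\<dots> = ennreal t * (mellin g p * moment \<nu> p)"
      by (subst mellin_cmult) (auto simp: mellin_of_integral \<nu> g)
    also have "\<dots> = K * ennreal (C * t)"
    proof -
      have "mellin g p * moment \<nu> p = K * ennreal C"
        using K unfolding C(2)[symmetric]
        by (metis ennreal_mult_divide_eq ennreal_times_divide infinity_ennreal_def mult.commute)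
      then show ?thesis using t C by (simp add: ennreal_mult mult_ac)
    qed
    finally show ?thesis using K by (simp add: ennreal_mult_le_mult_iff)
  qed
  with C(1) show ?thesis by blast
qed

section \<open>Characteristic exponents and moments of the Levy measure\<close>

lemma levy_measure_sigma_finite:
  assumes "levy_measure \<nu>"
  shows "sigma_finite_measure \<nu>"
proof
  have [measurable_cong, simp]: "sets \<nu> = sets borel" and [simp]: "emeasure \<nu> {0} = 0"
    and fin: "(\<integral>\<^sup>+x. ennreal (min (x\<^sup>2) 1) \<partial>\<nu>) < \<infinity>"
    using assms by (auto simp: levy_measure_def)
  have sp [simp]: "space \<nu> = UNIV" by (simp add: sets_eq_imp_space_eq[of \<nu> borel])
  \<comment> \<open>Markov's inequality bounds the measure of each set; only the null set of $0$ remains uncovered.\<close>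
  define A where "A n = {x::real. 1 \<le> ennreal (real (Suc n)) * ennreal (min (x\<^sup>2) 1)}" for n :: nat
  have [measurable]: "A n \<in> sets borel" for n by (simp add: A_def)
  have "emeasure \<nu> (A n) < \<infinity>" for n
  proof -
    have "emeasure \<nu> (A n) \<le> ennreal (real (Suc n)) * (\<integral>\<^sup>+x. ennreal (min (x\<^sup>2) 1) \<partial>\<nu>)"
      using nn_integral_Markov_inequality[of "\<lambda>x. ennreal (min (x\<^sup>2) 1)" UNIV \<nu> "ennreal (real (Suc n))"]
      by (simp add: A_def)
    also have "\<dots> < \<infinity>" using fin by (simp add: ennreal_mult_less_top)
    finally show ?thesis .
  qed
  moreover have "x \<in> A (nat \<lceil>1 / min (x\<^sup>2) 1\<rceil>)" if "x \<noteq> 0" for x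
  proof -
    have pos: "0 < min (x\<^sup>2) 1" using that by simp
    have "1 / min (x\<^sup>2) 1 \<le> real (Suc (nat \<lceil>1 / min (x\<^sup>2) 1\<rceil>))" by linarith
    then have "1 \<le> real (Suc (nat \<lceil>1 / min (x\<^sup>2) 1\<rceil>)) * min (x\<^sup>2) 1"
      using pos by (simp only: pos_divide_le_eq)
    then show ?thesis unfolding A_def by (simp only: mem_Collect_eq ennreal_mult'[symmetric] of_nat_0_le_iff) (simp add: ennreal_1[symmetric] del: ennreal_1)
  qed
  ultimately show "\<exists>A. countable A \<and> A \<subseteq> sets \<nu> \<and> \<Union>A = space \<nu> \<and> (\<forall>a\<in>A. emeasure \<nu> a \<noteq> \<infinity>)"
    by (intro exI[of _ "insert {0} (range A)"]) (auto simp: less_top)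
qed

text \<open>
  Taylor's formula of second order for small jumps, the trivial bound by two for large ones.
\<close>
lemma exp_compensated_bound:
  "norm (iexp (u * x) - 1 - \<i> * of_real (u * x * indicator {x. \<bar>x\<bar> \<le> 1} x)) \<le> (2 + u\<^sup>2) * min (x\<^sup>2) 1"
proof (cases "\<bar>x\<bar> \<le> 1")
  case True
  have "norm (iexp (u * x) - (1 + \<i> * of_real (u * x))) \<le> (u * x)\<^sup>2 / 2"
    using iexp_approx1[of "u*x" 1] by (simp add: numeral_2_eq_2)
  also have "\<dots> \<le> (2 + u\<^sup>2) * x\<^sup>2" by (simp add: power_mult_distrib algebra_simps)
  finally show ?thesis using True by (simp add: diff_diff_eq abs_square_le_1 min_absorb1)
next
  case False
  have "norm (iexp (u * x) - 1) \<le> norm (iexp (u * x)) + norm (1::complex)" by (rule norm_triangle_ineq4)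
  also have "\<dots> \<le> 2 + u\<^sup>2" by (simp del: of_real_mult)
  also have "min (x\<^sup>2) 1 = 1" using False by (metis abs_square_le_1 linorder_le_cases min.absorb2)
  then have "2 + u\<^sup>2 = (2 + u\<^sup>2) * min (x\<^sup>2) 1" by simp
  finally show ?thesis using False by simp
qed

lemma levy_measure_integrable_bounded:
  fixes f :: "real \<Rightarrow> 'b::{banach, second_countable_topology}"
  assumes "levy_measure \<nu>" and [measurable]: "f \<in> borel_measurable borel"
    and "\<And>x. norm (f x) \<le> C * min (x\<^sup>2) 1"
  shows "integrable \<nu> f"
proof (rule Bochner_Integration.integrable_bound)
  have [measurable_cong, simp]: "sets \<nu> = sets borel" 
    and fin: "(\<integral>\<^sup>+x. ennreal (min (x\<^sup>2) 1) \<partial>\<nu>) < \<infinity>"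
    using assms by (auto simp: levy_measure_def)
  show "integrable \<nu> (\<lambda>x. C * min (x\<^sup>2) 1)" using fin by (auto intro!: integrableI_nonneg integrable_mult_right)
  show "f \<in> borel_measurable \<nu>" by simp
  show "AE x in \<nu>. norm (f x) \<le> norm (C * min (x\<^sup>2) 1)"
    by (intro AE_I2 order_trans[OF assms(3)]) simp
qed

lemma levy_measure_integrable_exponent:
  assumes "levy_measure \<nu>"
  shows "integrable \<nu> (\<lambda>x. iexp (u * x) - 1 - \<i> * of_real (u * x * indicator {x. \<bar>x\<bar> \<le> 1} x))"
  using assms _ exp_compensated_bound by (rule levy_measure_integrable_bounded) measurable

lemma levy_measure_integrable_cos:
  assumes "levy_measure \<nu>"
  shows "integrable \<nu> (\<lambda>x. 1 - cos (u * x))"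
  using levy_measure_integrable_exponent[OF assms, THEN integrable_Re, of u, THEN integrable_minus]
  by (simp add: Re_exp)

lemma Re_levy_exponent:
  assumes "levy_measure \<nu>"
  shows "Re (levy_exponent a 0 \<nu> u) = (LINT x|\<nu>. 1 - cos (u * x))"
  unfolding levy_exponent_def
  apply (simp add: integral_Re[symmetric] levy_measure_integrable_exponent[OF assms, simplified])
  apply (simp add: Re_exp Bochner_Integration.integral_minus[symmetric] del: Bochner_Integration.integral_minus)
  done

lemma Im_levy_exponent:
  assumes "levy_measure \<nu>"
  shows "Im (levy_exponent a 0 \<nu> u) = - u * a - (LINT x|\<nu>. sin (u * x) - u * x * indicator {x. \<bar>x\<bar> \<le> 1} x)"
  unfolding levy_exponent_def
  apply (simp add: integral_Im[symmetric] levy_measure_integrable_exponent[OF assms, simplified])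
  apply (simp add: Im_exp)
  done

lemma Re_levy_exponent_nonneg: "levy_measure \<nu> \<Longrightarrow> 0 \<le> Re (levy_exponent a 0 \<nu> u)"
  by (simp add: Re_levy_exponent)

lemma ennreal_Re_levy_exponent:
  assumes "levy_measure \<nu>"
  shows "ennreal (Re (levy_exponent a 0 \<nu> u)) = (\<integral>\<^sup>+x. ennreal (1 - cos (u * \<bar>x\<bar>)) \<partial>\<nu>)"
proof -
  have "cos (u * \<bar>x\<bar>) = cos (u * x)" for x by (cases "0 \<le> x") auto
  then show ?thesis
    using levy_measure_integrable_cos[OF assms, of u] by (simp add: Re_levy_exponent assms nn_integral_eq_integral)
qed

lemma Re_levy_exponent_bounded:
  assumes "levy_measure \<nu>"
  shows "\<exists>B. \<forall>u. \<bar>u\<bar> \<le> 1 \<longrightarrow> Re (levy_exponent a 0 \<nu> u) \<le> B"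
proof (intro exI allI impI)
  fix u :: real assume u: "\<bar>u\<bar> \<le> 1"
  show "Re (levy_exponent a 0 \<nu> u) \<le> (LINT x|\<nu>. 2 * min (x\<^sup>2) 1)"
    unfolding Re_levy_exponent[OF assms]
  proof (rule integral_mono)
    show "integrable \<nu> (\<lambda>x. 2 * min (x\<^sup>2) 1)"
      by (rule levy_measure_integrable_bounded[OF assms, of _ 2]) auto
    show "1 - cos (u * x) \<le> 2 * min (x\<^sup>2) 1" for x
    proof -
      have "(u * x)\<^sup>2 \<le> x\<^sup>2" using u by (simp add: power_mult_distrib mult_left_le_one_le abs_square_le_1)
      then show ?thesis
        using one_minus_cos_le_square[of "u*x"] cos_ge_minus_one[of "u*x"] zero_le_power2[of x] by linarith
    qed
  qed (rule levy_measure_integrable_cos[OF assms])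
qed

text \<open>
  Near the origin $R = Re\,\Psi$ is bounded by some $B$, so that $R \<le> e^B (1 - e^{-R}) \<le> e^B (1 - Re\,\hat\mu)$. Hence
  the moment formula for $\mu$ bounds the Mellin transform of $R$ restricted to $u \<le> 1$, and for $|x| > 1$ that
  range of $u$ already sees a fixed fraction of $|x|^p$.
\<close>
lemma large_jump_moment_finite:
  assumes p: "0 < p" "p < 2" and \<nu>: "levy_measure \<nu>" and \<mu>: "real_distribution \<mu>"
    and char: "\<And>u. char \<mu> u = exp (- levy_exponent a 0 \<nu> u)" and m: "moment \<mu> p < \<infinity>"
  shows "(\<integral>\<^sup>+x. indicator {x. 1 < \<bar>x\<bar>} x * ennreal (\<bar>x\<bar> powr p) \<partial>\<nu>) < \<infinity>" (is "?I < _")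
proof -
  have \<nu>_sets [measurable_cong, simp]: "sets \<nu> = sets borel" using \<nu> by (simp add: levy_measure_def)
  interpret real_distribution \<mu> by fact
  obtain B where B: "\<And>u. \<bar>u\<bar> \<le> 1 \<Longrightarrow> Re (levy_exponent a 0 \<nu> u) \<le> B"
    using Re_levy_exponent_bounded[OF \<nu>] by blast
  \<comment> \<open>The cut-off makes the profile vanish for $u > 1$ when $|x| > 1$, where $1 - e^{-R}$ need not control $R$.\<close>
  define g where "g v = ennreal (1 - cos v) * indicator {..1} v" for v :: real
  have [measurable]: "g \<in> borel_measurable borel" unfolding g_def[abs_def] by measurable
  have "mellin g p * ?I = mellin (\<lambda>u. \<integral>\<^sup>+x. indicator {x. 1 < \<bar>x\<bar>} x * g (u * \<bar>x\<bar>) \<partial>\<nu>) p"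
    by (rule mellin_of_weighted_integral[symmetric]) (auto simp: g_def levy_measure_sigma_finite[OF \<nu>])
  also have "\<dots> \<le> mellin (\<lambda>u. ennreal (exp B) * ennreal (1 - Re (char \<mu> u))) p"
  proof (rule mellin_mono)
    fix u :: real assume u: "0 < u"
    show "(\<integral>\<^sup>+x. indicator {x. 1 < \<bar>x\<bar>} x * g (u * \<bar>x\<bar>) \<partial>\<nu>)
      \<le> ennreal (exp B) * ennreal (1 - Re (char \<mu> u))"
    proof (cases "u \<le> 1")
      case True
      define R where "R = Re (levy_exponent a 0 \<nu> u)"
      have R: "0 \<le> R" "R \<le> B" using B[of u] u True Re_levy_exponent_nonneg[OF \<nu>] by (auto simp: R_def)
      have "(\<integral>\<^sup>+x. indicator {x. 1 < \<bar>x\<bar>} x * g (u * \<bar>x\<bar>) \<partial>\<nu>) \<le> ennreal R"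
        unfolding R_def ennreal_Re_levy_exponent[OF \<nu>]
        by (intro nn_integral_mono) (auto simp: g_def split: split_indicator)
      also have "R \<le> exp B * (1 - exp (- R))"
      proof -
        have "R \<le> exp R * (1 - exp (- R))" using exp_ge_add_one_self[of R] by (simp add: algebra_simps exp_minus_inverse)
        also have "\<dots> \<le> exp B * (1 - exp (- R))" using R by (intro mult_right_mono) auto
        finally show ?thesis .
      qed
      then have "ennreal R \<le> ennreal (exp B * (1 - exp (- R)))" by (rule ennreal_leI)
      also have "\<dots> \<le> ennreal (exp B * (1 - Re (char \<mu> u)))"
      proof -
        have "Re (char \<mu> u) \<le> exp (- R)"
          using complex_Re_le_cmod[of "char \<mu> u"] by (simp add: char R_def)
        then show ?thesis by (intro ennreal_leI) auto
      qed
      finally show ?thesis by (simp add: ennreal_mult')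
    next
      case False
      have "\<not> u * \<bar>x\<bar> \<le> 1" if "1 < \<bar>x\<bar>" for x
        using False that mult_strict_mono[of 1 u 1 "\<bar>x\<bar>"] by auto
      then have "(\<integral>\<^sup>+x. indicator {x. 1 < \<bar>x\<bar>} x * g (u * \<bar>x\<bar>) \<partial>\<nu>) = (\<integral>\<^sup>+x. 0 \<partial>\<nu>)"
        by (intro nn_integral_cong) (auto simp: g_def split: split_indicator)
      then show ?thesis by simp
    qed
  qed
  also have "\<dots> = ennreal (exp B) * (mellin (\<lambda>v. ennreal (1 - cos v)) p * moment \<mu> p)"
    by (subst mellin_cmult) (auto simp: mellin_one_minus_Re_char[OF \<mu>])
  also have "\<dots> < \<infinity>"
    using mellin_one_minus_cos_finite[OF p] m by (simp add: ennreal_mult_less_top)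
  finally have "mellin g p * ?I < \<infinity>" .
  moreover have "0 < mellin g p"
  proof (rule mellin_pos)
    show "0 < g u" if "0 < u" "u < 1" for u
      using one_minus_cos_pos[OF that] that by (simp add: g_def ennreal_less_zero_iff)
  qed measurable
  ultimately show ?thesis by (auto simp: ennreal_mult_less_top)
qed

lemma moment_levy_measure_finite:
  assumes p: "0 < p" "p < 2" and \<nu>: "levy_measure \<nu>" and \<mu>: "real_distribution \<mu>"
    and char: "\<And>u. char \<mu> u = exp (- levy_exponent a 0 \<nu> u)" and m: "moment \<mu> p < \<infinity>"
    and small: "small_jump_moment \<nu> p < \<infinity>"
  shows "moment \<nu> p < \<infinity>"
proof -
  have \<nu>_sets [measurable_cong, simp]: "sets \<nu> = sets borel" using \<nu> by (simp add: levy_measure_def)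
  have "moment \<nu> p = (\<integral>\<^sup>+x. ennreal (\<bar>x\<bar> powr p) * indicator {x. \<bar>x\<bar> \<le> 1} x
      + indicator {x. 1 < \<bar>x\<bar>} x * ennreal (\<bar>x\<bar> powr p) \<partial>\<nu>)"
    unfolding moment_def by (intro nn_integral_cong) (auto split: split_indicator)
  also have "\<dots> = small_jump_moment \<nu> p + (\<integral>\<^sup>+x. indicator {x. 1 < \<bar>x\<bar>} x * ennreal (\<bar>x\<bar> powr p) \<partial>\<nu>)"
    unfolding small_jump_moment_def by (intro nn_integral_add) auto
  also have "\<dots> < \<infinity>"
    using small large_jump_moment_finite[OF p \<nu> \<mu> char m] by simp
  finally show ?thesis .
qed

lemma one_minus_Re_exp_le:
  assumes "0 \<le> Re z"
  shows "1 - Re (exp (- z)) \<le> Re z + \<bar>Im z\<bar>"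
proof -
  have "1 - Re (exp (- z)) = (1 - exp (- Re z)) + exp (- Re z) * (1 - cos (Im z))"
    by (simp add: Re_exp algebra_simps)
  also have "1 - exp (- Re z) \<le> Re z" using exp_ge_add_one_self[of "- Re z"] by simp
  also have "exp (- Re z) * (1 - cos (Im z)) \<le> 1 * (1 - cos (Im z))"
    using assms by (intro mult_right_mono) auto
  also have "1 - cos v \<le> \<bar>v\<bar>" for v :: real
  proof (cases "\<bar>v\<bar> \<le> 2")
    case True
    then have "v\<^sup>2 \<le> 2 * \<bar>v\<bar>" using mult_right_mono[OF True, of "\<bar>v\<bar>"] by (simp add: power2_eq_square)
    then show ?thesis using one_minus_cos_le_square[of v] by linarith
  next
    case False
    then show ?thesis using cos_ge_minus_one[of v] by linarith
  qed
  finally show ?thesis by simp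
qed

text \<open>
  Here the exponent is real, so $1 - e^{-2tR} \<le> 2tR$ is a bound without any contribution of the drift, valid
  for all $t$.
\<close>
lemma moment_bound_of_symmetrized_char:
  assumes p: "0 < p" "p < 2" and \<nu>: "levy_measure \<nu>" and m: "moment \<nu> p < \<infinity>"
  shows "\<exists>C\<ge>0. \<forall>t\<ge>0. \<forall>\<mu>. real_distribution \<mu> \<longrightarrow>
    (\<forall>u. char \<mu> u = of_real (exp (- 2 * t * Re (levy_exponent a 0 \<nu> u)))) \<longrightarrow> moment \<mu> p \<le> ennreal (C * t)"
proof -
  have \<nu>_sets: "sets \<nu> = sets borel" using \<nu> by (simp add: levy_measure_def)
  obtain C where C: "0 \<le> C" "\<And>t \<mu>. 0 \<le> t \<Longrightarrow> real_distribution \<mu> \<Longrightarrow>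
      (\<And>u. 0 < u \<Longrightarrow> ennreal (1 - Re (char \<mu> u)) \<le> ennreal t * (\<integral>\<^sup>+x. ennreal (1 - cos (u * \<bar>x\<bar>)) \<partial>\<nu>))
      \<Longrightarrow> moment \<mu> p \<le> ennreal (C * t)"
    using moment_le_of_char[OF p levy_measure_sigma_finite[OF \<nu>] \<nu>_sets, of "\<lambda>v. ennreal (1 - cos v)"]
      mellin_one_minus_cos_finite[OF p] m by auto
  have "moment \<mu> p \<le> ennreal (2 * C * t)" if t: "0 \<le> t" and \<mu>: "real_distribution \<mu>"
    and char: "\<And>u. char \<mu> u = of_real (exp (- 2 * t * Re (levy_exponent a 0 \<nu> u)))" for t \<mu>
  proof -
    have "moment \<mu> p \<le> ennreal (C * (2 * t))"
    proof (rule C(2)[OF _ \<mu>])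
      fix u :: real
      have "1 - Re (char \<mu> u) \<le> 2 * t * Re (levy_exponent a 0 \<nu> u)"
        unfolding char Re_complex_of_real
        using exp_ge_add_one_self[of "- 2 * t * Re (levy_exponent a 0 \<nu> u)"] by linarith
      then show "ennreal (1 - Re (char \<mu> u)) \<le> ennreal (2 * t) * (\<integral>\<^sup>+x. ennreal (1 - cos (u * \<bar>x\<bar>)) \<partial>\<nu>)"
        unfolding ennreal_Re_levy_exponent[OF \<nu>, of a, symmetric]
        using t by (subst ennreal_mult[symmetric]) (auto intro!: ennreal_leI Re_levy_exponent_nonneg \<nu>)
    qed (use t in simp)
    then show ?thesis by (simp add: mult_ac)
  qed
  with C(1) show ?thesis by (intro exI[of _ "2 * C"]) auto
qed

text \<open>
  On $|x| \<le> 1$ a lower power dominates a higher one; this makes the drift $a - \int_{|x| \<le> 1} x\,d\nu$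
  meaningful.
\<close>
lemma set_integrable_jump_size:
  assumes \<nu>: "levy_measure \<nu>" and p: "p \<le> 1" and small: "small_jump_moment \<nu> p < \<infinity>"
  shows "set_integrable \<nu> {x. \<bar>x\<bar> \<le> 1} (\<lambda>x. x)"
proof -
  have [measurable_cong, simp]: "sets \<nu> = sets borel" using \<nu> by (simp add: levy_measure_def)
  have "(\<integral>\<^sup>+x. ennreal (norm (indicator {x. \<bar>x\<bar> \<le> 1} x *\<^sub>R x)) \<partial>\<nu>) \<le> small_jump_moment \<nu> p"
    unfolding small_jump_moment_def
  proof (intro nn_integral_mono)
    fix x :: real
    have "\<bar>x\<bar> \<le> \<bar>x\<bar> powr p" if "\<bar>x\<bar> \<le> 1"
      using powr_mono'[of p 1 "\<bar>x\<bar>"] p that by (cases "x = 0") auto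
    then show "ennreal (norm (indicator {x. \<bar>x\<bar> \<le> 1} x *\<^sub>R x)) \<le> ennreal (\<bar>x\<bar> powr p) * indicator {x. \<bar>x\<bar> \<le> 1} x"
      by (auto split: split_indicator intro: ennreal_leI)
  qed
  also note small
  finally show ?thesis unfolding set_integrable_def by (auto intro!: integrableI_bounded)
qed

text \<open>
  With $b$ subtracted, the compensating term of the exponent cancels, which leaves $-\int (e^{iux} - 1)\,d\nu$. Its
  real and imaginary parts are integrals of the dilates of $1 - \cos$ and $\sin$, and $1 - \cos v + |\sin v|$ is
  $O(v)$ at the origin, which is integrable against $v^{-1-p}$ exactly because $p < 1$.
\<close>
lemma moment_bound_of_driftless_char:
  fixes a :: real
  assumes p: "0 < p" "p < 1" and \<nu>: "levy_measure \<nu>" and m: "moment \<nu> p < \<infinity>"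
  defines "b \<equiv> a - (LINT x:{x. \<bar>x\<bar> \<le> 1}|\<nu>. x)"
  shows "\<exists>C\<ge>0. \<forall>t\<ge>0. \<forall>\<mu>. real_distribution \<mu> \<longrightarrow>
    (\<forall>u. char \<mu> u = exp (- of_real t * (levy_exponent a 0 \<nu> u + \<i> * of_real (u * b)))) \<longrightarrow>
    moment \<mu> p \<le> ennreal (C * t)"
proof -
  have \<nu>_sets [measurable_cong, simp]: "sets \<nu> = sets borel" using \<nu> by (simp add: levy_measure_def)
  have "small_jump_moment \<nu> p \<le> moment \<nu> p"
    unfolding small_jump_moment_def moment_def by (intro nn_integral_mono) (auto split: split_indicator)
  then have small: "small_jump_moment \<nu> p < \<infinity>" using m by simp
  have int1: "integrable \<nu> (\<lambda>x. u * x * indicator {x. \<bar>x\<bar> \<le> 1} x)" for u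
    using integrable_mult_right[OF set_integrable_jump_size[OF \<nu> _ small, unfolded set_integrable_def], of u] p
    by (simp add: mult_ac)
  have int2: "integrable \<nu> (\<lambda>x. sin (u * x) - u * x * indicator {x. \<bar>x\<bar> \<le> 1} x)" for u
    using integrable_Im[OF levy_measure_integrable_exponent[OF \<nu>, of u]] by (simp add: Im_exp)
  have int3: "integrable \<nu> (\<lambda>x. sin (u * x))" for u
    using Bochner_Integration.integrable_add[OF int1 int2, of u u] by simp
  define g where "g v = ennreal (1 - cos v + \<bar>sin v\<bar>)" for v :: real
  have g [measurable]: "g \<in> borel_measurable borel" unfolding g_def[abs_def] by measurable
  have g0: "g 0 = 0" by (simp add: g_def)
  have "mellin g p < \<infinity>"
  proof (rule mellin_finite[where r=0 and s=1 and C=3])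
    fix v :: real assume v: "0 < v"
    have "v\<^sup>2 \<le> v" if "v \<le> 1" using that v by (simp add: power2_eq_square)
    then have "1 - cos v + \<bar>sin v\<bar> \<le> 3 * v" if "v \<le> 1"
      using that one_minus_cos_le_square[of v] abs_sin_x_le_abs_x[of v] v by linarith
    moreover have "1 - cos v + \<bar>sin v\<bar> \<le> 3"
      using cos_ge_minus_one[of v] abs_sin_le_one[of v] by linarith
    ultimately have "1 - cos v + \<bar>sin v\<bar> \<le> 3 * min 1 v" by (simp add: min_def)
    then show "g v \<le> ennreal (3 * min (v powr 0) (v powr 1))"
      using v unfolding g_def by (intro ennreal_leI) simp
  qed (use p in auto)
  then obtain C where C: "0 \<le> C" "\<And>t \<mu>. 0 \<le> t \<Longrightarrow> real_distribution \<mu> \<Longrightarrow>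
      (\<And>u. 0 < u \<Longrightarrow> ennreal (1 - Re (char \<mu> u)) \<le> ennreal t * (\<integral>\<^sup>+x. g (u * \<bar>x\<bar>) \<partial>\<nu>))
      \<Longrightarrow> moment \<mu> p \<le> ennreal (C * t)"
    using moment_le_of_char[OF p(1) _ levy_measure_sigma_finite[OF \<nu>] \<nu>_sets, of g] g g0 p m by auto
  have "moment \<mu> p \<le> ennreal (C * t)" if t: "0 \<le> t" and \<mu>: "real_distribution \<mu>"
    and char: "\<And>u. char \<mu> u = exp (- of_real t * (levy_exponent a 0 \<nu> u + \<i> * of_real (u * b)))" for t \<mu>
  proof (rule C(2)[OF t \<mu>])
    fix u :: real assume "0 < u"
    define z where "z = levy_exponent a 0 \<nu> u + \<i> * of_real (u * b)"
    have Re: "Re z = (LINT x|\<nu>. 1 - cos (u * x))" by (simp add: z_def Re_levy_exponent \<nu>)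
    have "Im z = - (LINT x|\<nu>. sin (u * x) - u * x * indicator {x. \<bar>x\<bar> \<le> 1} x)
        - u * (LINT x:{x. \<bar>x\<bar> \<le> 1}|\<nu>. x)"
      by (simp add: z_def Im_levy_exponent \<nu> b_def algebra_simps)
    also have "u * (LINT x:{x. \<bar>x\<bar> \<le> 1}|\<nu>. x) = (LINT x|\<nu>. u * x * indicator {x. \<bar>x\<bar> \<le> 1} x)"
      unfolding set_lebesgue_integral_def by (subst integral_mult_right_zero[symmetric]) (simp add: mult_ac)
    finally have Im: "Im z = - (LINT x|\<nu>. sin (u * x))" using int1 int2 int3 by simp
    have "1 - Re (char \<mu> u) \<le> Re (of_real t * z) + \<bar>Im (of_real t * z)\<bar>"
      using one_minus_Re_exp_le[of "of_real t * z"] t by (simp add: char z_def Re_levy_exponent_nonneg[OF \<nu>])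
    also have "\<dots> = t * (Re z + \<bar>Im z\<bar>)" using t by (simp add: abs_mult algebra_simps)
    also have "\<dots> \<le> t * (LINT x|\<nu>. 1 - cos (u * x) + \<bar>sin (u * x)\<bar>)"
    proof (rule mult_left_mono[OF _ t])
      have "Re z + \<bar>Im z\<bar> \<le> Re z + (LINT x|\<nu>. \<bar>sin (u * x)\<bar>)"
        using integral_norm_bound[of \<nu> "\<lambda>x. sin (u * x)"] by (simp add: Im)
      also have "\<dots> = (LINT x|\<nu>. 1 - cos (u * x) + \<bar>sin (u * x)\<bar>)"
        unfolding Re using int3 levy_measure_integrable_cos[OF \<nu>]
        by (intro Bochner_Integration.integral_add[symmetric] integrable_abs) auto
      finally show "Re z + \<bar>Im z\<bar> \<le> (LINT x|\<nu>. 1 - cos (u * x) + \<bar>sin (u * x)\<bar>)" .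
    qed
    finally have "ennreal (1 - Re (char \<mu> u)) \<le> ennreal (t * (LINT x|\<nu>. 1 - cos (u * x) + \<bar>sin (u * x)\<bar>))"
      by (rule ennreal_leI)
    also have "\<dots> = ennreal t * ennreal (LINT x|\<nu>. 1 - cos (u * x) + \<bar>sin (u * x)\<bar>)" using t by (simp add: ennreal_mult')
    also have "ennreal (LINT x|\<nu>. 1 - cos (u * x) + \<bar>sin (u * x)\<bar>) = (\<integral>\<^sup>+x. ennreal (1 - cos (u * x) + \<bar>sin (u * x)\<bar>) \<partial>\<nu>)"
      using int3 levy_measure_integrable_cos[OF \<nu>]
      by (intro nn_integral_eq_integral[symmetric] Bochner_Integration.integrable_add integrable_abs) (auto intro: add_nonneg_nonneg)
    also have "\<dots> = (\<integral>\<^sup>+x. g (u * \<bar>x\<bar>) \<partial>\<nu>)"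
    proof (rule nn_integral_cong)
      show "ennreal (1 - cos (u * x) + \<bar>sin (u * x)\<bar>) = g (u * \<bar>x\<bar>)" for x
        by (cases "0 \<le> x") (auto simp: g_def)
    qed
    finally show "ennreal (1 - Re (char \<mu> u)) \<le> ennreal t * (\<integral>\<^sup>+x. g (u * \<bar>x\<bar>) \<partial>\<nu>)" .
  qed
  with C(1) show ?thesis by blast
qed

section \<open>Inequalities for powers\<close>

text \<open>
  Young's inequality in the form of a tangent inequality for the convex function $s \<mapsto> s^p$ at $m$. It serves
  three times: for convexity in Clarkson's inequality, for Jensen's inequality, and for the Doob step.
\<close>
lemma young_powr:
  fixes s m p :: real
  assumes p: "1 \<le> p" and s: "0 \<le> s" and m: "0 \<le> m"
  shows "p * s * m powr (p - 1) \<le> (p - 1) * m powr p + s powr p"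
proof (cases "p = 1 \<or> m = 0")
  case True
  then show ?thesis using s m p by (cases "m = 0") auto
next
  case False
  then have p: "1 < p" and m: "0 < m" using p m by auto
  have "s * m powr (p - 1) \<le> s powr p / p + (m powr (p - 1)) powr (p / (p - 1)) / (p / (p - 1))"
    using p s by (intro Youngs_inequality) (auto simp: field_simps)
  also have "(m powr (p - 1)) powr (p / (p - 1)) = m powr p" using p by (simp add: powr_powr)
  finally show ?thesis using p by (simp add: field_simps)
qed

lemma powr_add_le_powr_sum:
  fixes a b q :: real
  assumes "1 \<le> q" "0 \<le> a" "0 \<le> b"
  shows "a powr q + b powr q \<le> (a + b) powr q"
proof -
  have *: "x powr q \<le> x * (a + b) powr (q - 1)" if "0 \<le> x" "x \<le> a + b" for x
  proof -
    have "x powr q = x * x powr (q - 1)" using that by (cases "x = 0") (auto simp: powr_mult_base)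
    then show ?thesis using that assms by (auto intro!: mult_left_mono powr_mono2)
  qed
  have "a powr q + b powr q \<le> (a + b) * (a + b) powr (q - 1)"
    using *[of a] *[of b] assms by (simp add: distrib_right)
  also have "\<dots> = (a + b) powr q" using assms by (cases "a + b = 0") (auto simp: powr_mult_base)
  finally show ?thesis .
qed

text \<open>
  Put $q = p/2$. Convexity of the $q$-th power at the mean $x^2 + y^2$ of $(x+y)^2$ and $(x-y)^2$, followed by its
  superadditivity.
\<close>
lemma clarkson_powr:
  fixes x y p :: real
  assumes p: "2 \<le> p"
  shows "2 * (\<bar>x\<bar> powr p + \<bar>y\<bar> powr p) \<le> \<bar>x + y\<bar> powr p + \<bar>x - y\<bar> powr p"
proof -
  define q where "q = p / 2"
  have q: "1 \<le> q" using p by (simp add: q_def)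
  have sq: "\<bar>z\<bar> powr p = (z\<^sup>2) powr q" for z :: real
  proof -
    have "z\<^sup>2 = \<bar>z\<bar> powr 2" by simp
    then show ?thesis unfolding q_def by (simp only: powr_powr) simp
  qed
  define w where "w = x\<^sup>2 + y\<^sup>2"
  have w: "0 \<le> w" by (simp add: w_def)
  have "2 * (\<bar>x\<bar> powr p + \<bar>y\<bar> powr p) \<le> 2 * w powr q"
    unfolding sq w_def using powr_add_le_powr_sum[OF q, of "x\<^sup>2" "y\<^sup>2"] by simp
  also have "2 * w powr q \<le> ((x + y)\<^sup>2) powr q + ((x - y)\<^sup>2) powr q"
  proof -
    have "w * w powr (q - 1) = w powr q" using w by (cases "w = 0") (auto simp: powr_mult_base)
    moreover have "(x + y)\<^sup>2 + (x - y)\<^sup>2 = 2 * w" by (simp add: w_def power2_eq_square algebra_simps)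
    then have "q * (x + y)\<^sup>2 * w powr (q - 1) + q * (x - y)\<^sup>2 * w powr (q - 1) = 2 * q * (w * w powr (q - 1))"
      by (simp only: distrib_right[symmetric] distrib_left[symmetric])
    ultimately show ?thesis
      using young_powr[OF q, of "(x+y)\<^sup>2" w] young_powr[OF q, of "(x-y)\<^sup>2" w] w by (simp add: algebra_simps)
  qed
  finally show ?thesis unfolding sq .
qed

lemma powr_add_le:
  fixes x y p :: real
  assumes "0 \<le> p"
  shows "\<bar>x + y\<bar> powr p \<le> 2 powr p * (\<bar>x\<bar> powr p + \<bar>y\<bar> powr p)"
proof -
  have "\<bar>x + y\<bar> powr p \<le> (2 * max \<bar>x\<bar> \<bar>y\<bar>) powr p" using assms by (intro powr_mono2) auto
  also have "\<dots> = 2 powr p * max \<bar>x\<bar> \<bar>y\<bar> powr p" by (simp add: powr_mult)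
  also have "\<dots> \<le> 2 powr p * (\<bar>x\<bar> powr p + \<bar>y\<bar> powr p)" by (intro mult_left_mono) (auto simp: max_def)
  finally show ?thesis .
qed

section \<open>Symmetrised laws and convolution semigroups\<close>

lemma real_distribution_convolution:
  assumes "real_distribution \<mu>" "real_distribution \<nu>"
  shows "real_distribution (\<mu> \<star> \<nu>)"
proof -
  interpret \<mu>: real_distribution \<mu> by fact
  interpret \<nu>: real_distribution \<nu> by fact
  interpret pair_prob_space \<mu> \<nu> ..
  show ?thesis unfolding convolution_def by (intro real_distribution_distr) measurable
qed

lemma char_convolution:
  assumes "real_distribution \<mu>" "real_distribution \<nu>"
  shows "char (\<mu> \<star> \<nu>) u = char \<mu> u * char \<nu> u"
proof -
  interpret \<mu>: real_distribution \<mu> by fact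
  interpret \<nu>: real_distribution \<nu> by fact
  interpret pair_prob_space \<mu> \<nu> ..
  have "char (\<mu> \<star> \<nu>) u = (CLINT z|\<mu> \<Otimes>\<^sub>M \<nu>. iexp (u * (fst z + snd z)))"
    unfolding convolution_def char_def by (subst integral_distr) (auto simp: case_prod_beta)
  also have "\<dots> = (CLINT x|\<mu>. CLINT y|\<nu>. iexp (u * (x + y)))"
    by (subst integral_fst'[symmetric]) (auto intro!: integrable_iexp)
  also have "\<dots> = (CLINT x|\<mu>. iexp (u * x) * char \<nu> u)"
    unfolding char_def by (simp add: exp_add distrib_left)
  also have "\<dots> = char \<mu> u * char \<nu> u" by (simp add: char_def)
  finally show ?thesis .
qed

text \<open>
  The law of $X - X'$ for independent $X$ and $X'$ with law $\mu$.
\<close>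
definition symmetrize :: "real measure \<Rightarrow> real measure" where
  "symmetrize \<mu> = (\<mu> \<star> distr \<mu> borel uminus)"

context real_distribution
begin

lemma real_distribution_uminus: "real_distribution (distr M borel uminus)"
  by (rule real_distribution_distr) simp

lemma char_uminus: "char (distr M borel uminus) u = cnj (char M u)"
proof -
  have "char (distr M borel uminus) u = (CLINT x|M. cnj (iexp (u * x)))"
    unfolding char_def by (subst integral_distr) (auto simp: exp_cnj)
  then show ?thesis by (simp add: char_def)
qed

lemma real_distribution_symmetrize: "real_distribution (symmetrize M)"
  unfolding symmetrize_def
  by (intro real_distribution_convolution real_distribution_uminus real_distribution_axioms)

lemma char_symmetrize: "char (symmetrize M) u = of_real ((norm (char M u))\<^sup>2)"
  unfolding symmetrize_def complex_norm_square
  by (subst char_convolution) (auto simp: char_uminus real_distribution_uminus real_distribution_axioms)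

lemma nn_integral_symmetrize:
  assumes [measurable]: "f \<in> borel_measurable borel"
  shows "(\<integral>\<^sup>+x. f x \<partial>symmetrize M) = (\<integral>\<^sup>+x. \<integral>\<^sup>+y. f (x - y) \<partial>M \<partial>M)"
proof -
  interpret m: real_distribution "distr M borel uminus" by (rule real_distribution_uminus)
  show ?thesis unfolding symmetrize_def
    by (subst nn_integral_convolution) (auto simp: nn_integral_distr finite_measure_axioms m.finite_measure_axioms)
qed

lemma moment_symmetrize_finite:
  assumes p: "0 \<le> p" and m: "moment M p < \<infinity>"
  shows "moment (symmetrize M) p < \<infinity>"
proof -
  have "moment (symmetrize M) p = (\<integral>\<^sup>+x. \<integral>\<^sup>+y. ennreal (\<bar>x - y\<bar> powr p) \<partial>M \<partial>M)"
    unfolding moment_def by (rule nn_integral_symmetrize) simp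
  also have "\<dots> \<le> (\<integral>\<^sup>+x. \<integral>\<^sup>+y. ennreal (2 powr p) * (ennreal (\<bar>x\<bar> powr p) + ennreal (\<bar>y\<bar> powr p)) \<partial>M \<partial>M)"
    using powr_add_le[OF p, of _ "- _"]
    by (intro nn_integral_mono) (simp add: ennreal_mult[symmetric] flip: ennreal_plus)
  also have "\<dots> = ennreal (2 powr p) * (moment M p + moment M p)"
    by (simp add: nn_integral_cmult nn_integral_add moment_def emeasure_space_1 del: space_eq_univ)
  also have "\<dots> < \<infinity>" using m by (simp add: ennreal_mult_less_top)
  finally show ?thesis .
qed

text \<open>
  Jensen's inequality in the second coordinate of $X - X'$, in the pointwise form
  $|x - E X'|^p \<le> E |x - X'|^p$. It is derived from the tangent inequality at $|x - E X'|$.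
\<close>
lemma centered_moment_le_symmetrize:
  assumes p: "1 \<le> p" and int: "integrable M (\<lambda>x. x)"
  shows "(\<integral>\<^sup>+x. ennreal (\<bar>x - (LINT y|M. y)\<bar> powr p) \<partial>M) \<le> moment (symmetrize M) p"
proof -
  define e where "e = (LINT y|M. y)"
  have "ennreal (\<bar>x - e\<bar> powr p) \<le> (\<integral>\<^sup>+y. ennreal (\<bar>x - y\<bar> powr p) \<partial>M)" for x
  proof (cases "(\<integral>\<^sup>+y. ennreal (\<bar>x - y\<bar> powr p) \<partial>M) < \<infinity>")
    case True
    define w where "w = \<bar>x - e\<bar>"
    have w: "0 \<le> w" by (simp add: w_def)
    have i: "integrable M (\<lambda>y. \<bar>x - y\<bar> powr p)" using True by (intro integrableI_nonneg) auto
    have i1: "integrable M (\<lambda>y. \<bar>x - y\<bar>)" using int by (intro integrable_abs Bochner_Integration.integrable_diff) auto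
    have "w \<le> (LINT y|M. \<bar>x - y\<bar>)"
    proof -
      have "x - e = (LINT y|M. x - y)" unfolding e_def using int prob_space by (simp del: space_eq_univ)
      then show ?thesis unfolding w_def using integral_norm_bound[of M "\<lambda>y. x - y"] by simp
    qed
    then have "p * w * w powr (p - 1) \<le> p * (LINT y|M. \<bar>x - y\<bar>) * w powr (p - 1)"
      using p by (intro mult_right_mono mult_left_mono) auto
    also have "\<dots> = (LINT y|M. p * \<bar>x - y\<bar> * w powr (p - 1))" using i1 by simp
    also have "\<dots> \<le> (LINT y|M. (p - 1) * w powr p + \<bar>x - y\<bar> powr p)"
      using i i1 young_powr[OF p _ w] by (intro integral_mono) auto
    also have "\<dots> = (p - 1) * w powr p + (LINT y|M. \<bar>x - y\<bar> powr p)"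
      using i prob_space by (simp del: space_eq_univ)
    also have "p * w * w powr (p - 1) = p * w powr p" using w by (cases "w = 0") (auto simp: powr_mult_base)
    finally have "w powr p \<le> (LINT y|M. \<bar>x - y\<bar> powr p)" by (simp add: algebra_simps)
    then show ?thesis unfolding w_def using i by (subst nn_integral_eq_integral) (auto intro: ennreal_leI)
  qed (auto simp: less_top[symmetric])
  then show ?thesis
    unfolding moment_def e_def[symmetric] by (subst nn_integral_symmetrize) (auto intro: nn_integral_mono)
qed

end

lemma moment_convolution:
  assumes "real_distribution \<rho>\<^sub>1" "real_distribution \<rho>\<^sub>2"
  shows "moment (\<rho>\<^sub>1 \<star> \<rho>\<^sub>2) p = (\<integral>\<^sup>+x. \<integral>\<^sup>+y. ennreal (\<bar>x + y\<bar> powr p) \<partial>\<rho>\<^sub>2 \<partial>\<rho>\<^sub>1)"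
proof -
  interpret \<rho>1: real_distribution \<rho>\<^sub>1 by fact
  interpret \<rho>2: real_distribution \<rho>\<^sub>2 by fact
  show ?thesis unfolding moment_def
    by (subst nn_integral_convolution) (auto simp: \<rho>1.finite_measure_axioms \<rho>2.finite_measure_axioms)
qed

text \<open>
  By Tonelli's theorem some translate of $\nu$ has a finite first moment, hence so has $\nu$ itself.
\<close>
lemma moment_one_convolution_finite:
  assumes "real_distribution \<mu>" "real_distribution \<nu>" and m: "moment (\<mu> \<star> \<nu>) 1 < \<infinity>"
  shows "moment \<nu> 1 < \<infinity>"
proof -
  interpret \<mu>: real_distribution \<mu> by fact
  interpret \<nu>: real_distribution \<nu> by fact
  have "AE x in \<mu>. (\<integral>\<^sup>+y. ennreal (\<bar>x + y\<bar> powr 1) \<partial>\<nu>) \<noteq> \<infinity>"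
    using m unfolding moment_convolution[OF assms(1,2)] by (intro nn_integral_PInf_AE) auto
  then obtain x where x: "(\<integral>\<^sup>+y. ennreal (\<bar>x + y\<bar> powr 1) \<partial>\<nu>) \<noteq> \<infinity>"
    using eventually_happens \<mu>.ae_filter_bot by blast
  have "moment \<nu> 1 \<le> (\<integral>\<^sup>+y. ennreal (\<bar>x + y\<bar> powr 1) + ennreal \<bar>x\<bar> \<partial>\<nu>)"
    unfolding moment_def by (intro nn_integral_mono) (simp flip: ennreal_plus)
  also have "\<dots> = (\<integral>\<^sup>+y. ennreal (\<bar>x + y\<bar> powr 1) \<partial>\<nu>) + ennreal \<bar>x\<bar>"
    by (subst nn_integral_add) (auto simp: \<nu>.emeasure_space_1 simp del: \<nu>.space_eq_univ)
  also have "\<dots> < \<infinity>" using x by (simp add: less_top)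
  finally show ?thesis .
qed

text \<open>
  A symmetric summand may be replaced by its negative, so the moment of the sum is an average over both signs.
  This prepares the use of Clarkson's inequality.
\<close>
lemma moment_convolution_symmetric:
  assumes "real_distribution \<rho>\<^sub>1" "real_distribution \<rho>\<^sub>2" and sym: "distr \<rho>\<^sub>2 borel uminus = \<rho>\<^sub>2"
  shows "2 * moment (\<rho>\<^sub>1 \<star> \<rho>\<^sub>2) p =
    (\<integral>\<^sup>+x. \<integral>\<^sup>+y. ennreal (\<bar>x + y\<bar> powr p + \<bar>x - y\<bar> powr p) \<partial>\<rho>\<^sub>2 \<partial>\<rho>\<^sub>1)"
proof -
  interpret \<rho>1: real_distribution \<rho>\<^sub>1 by fact
  interpret \<rho>2: real_distribution \<rho>\<^sub>2 by fact
  have *: "(\<integral>\<^sup>+y. ennreal (\<bar>x - y\<bar> powr p) \<partial>\<rho>\<^sub>2) = (\<integral>\<^sup>+y. ennreal (\<bar>x + y\<bar> powr p) \<partial>\<rho>\<^sub>2)" for x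
    by (subst (2) sym[symmetric], subst nn_integral_distr) auto
  show ?thesis
    by (simp add: moment_convolution[OF assms(1,2)] ennreal_plus nn_integral_add * del: ennreal_plus[symmetric])
      (simp add: nn_integral_cmult mult_2[symmetric])
qed

lemma two_moments_eq:
  assumes "real_distribution \<rho>\<^sub>1" "real_distribution \<rho>\<^sub>2"
  shows "2 * (moment \<rho>\<^sub>1 p + moment \<rho>\<^sub>2 p) =
      (\<integral>\<^sup>+x. \<integral>\<^sup>+y. ennreal (2 * (\<bar>x\<bar> powr p + \<bar>y\<bar> powr p)) \<partial>\<rho>\<^sub>2 \<partial>\<rho>\<^sub>1)"
proof -
  interpret \<rho>1: real_distribution \<rho>\<^sub>1 by fact
  interpret \<rho>2: real_distribution \<rho>\<^sub>2 by fact
  show ?thesis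
    by (simp add: ennreal_mult ennreal_plus nn_integral_cmult nn_integral_add moment_def
        \<rho>1.emeasure_space_1 \<rho>2.emeasure_space_1 del: \<rho>1.space_eq_univ \<rho>2.space_eq_univ)
qed

lemma moment_convolution_superadditive:
  assumes "real_distribution \<rho>\<^sub>1" "real_distribution \<rho>\<^sub>2" and sym: "distr \<rho>\<^sub>2 borel uminus = \<rho>\<^sub>2"
    and p: "2 \<le> p"
  shows "moment \<rho>\<^sub>1 p + moment \<rho>\<^sub>2 p \<le> moment (\<rho>\<^sub>1 \<star> \<rho>\<^sub>2) p"
proof -
  interpret \<rho>1: real_distribution \<rho>\<^sub>1 by fact
  interpret \<rho>2: real_distribution \<rho>\<^sub>2 by fact
  have "2 * (moment \<rho>\<^sub>1 p + moment \<rho>\<^sub>2 p) =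
      (\<integral>\<^sup>+x. \<integral>\<^sup>+y. ennreal (2 * (\<bar>x\<bar> powr p + \<bar>y\<bar> powr p)) \<partial>\<rho>\<^sub>2 \<partial>\<rho>\<^sub>1)"
    by (rule two_moments_eq) fact+
  also have "\<dots> \<le> 2 * moment (\<rho>\<^sub>1 \<star> \<rho>\<^sub>2) p"
    unfolding moment_convolution_symmetric[OF assms(1-3)]
    by (intro nn_integral_mono ennreal_leI clarkson_powr p)
  finally show ?thesis by (subst (asm) ennreal_mult_le_mult_iff) auto
qed

lemma moment_two_convolution_additive:
  assumes "real_distribution \<rho>\<^sub>1" "real_distribution \<rho>\<^sub>2" and sym: "distr \<rho>\<^sub>2 borel uminus = \<rho>\<^sub>2"
  shows "moment (\<rho>\<^sub>1 \<star> \<rho>\<^sub>2) 2 = moment \<rho>\<^sub>1 2 + moment \<rho>\<^sub>2 2"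
proof -
  interpret \<rho>1: real_distribution \<rho>\<^sub>1 by fact
  interpret \<rho>2: real_distribution \<rho>\<^sub>2 by fact
  have "2 * (moment \<rho>\<^sub>1 2 + moment \<rho>\<^sub>2 2) =
      (\<integral>\<^sup>+x. \<integral>\<^sup>+y. ennreal (2 * (\<bar>x\<bar> powr 2 + \<bar>y\<bar> powr 2)) \<partial>\<rho>\<^sub>2 \<partial>\<rho>\<^sub>1)"
    by (rule two_moments_eq) fact+
  also have "\<dots> = 2 * moment (\<rho>\<^sub>1 \<star> \<rho>\<^sub>2) 2"
    unfolding moment_convolution_symmetric[OF assms(1-3)]
    by (intro nn_integral_cong) (simp add: power2_eq_square algebra_simps)
  finally show ?thesis by (subst (asm) ennreal_mult_cancel_left) auto
qed

text \<open>
  The one-dimensional laws of a Levy process, remembered only through their characteristic functions. Uniqueness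
  of characteristic functions recovers the semigroup property, also after symmetrisation, where the exponent
  becomes real.
\<close>
locale char_semigroup =
  fixes \<mu> :: "real \<Rightarrow> real measure" and \<psi> :: "real \<Rightarrow> complex"
  assumes distribution: "\<And>t. 0 \<le> t \<Longrightarrow> real_distribution (\<mu> t)"
    and char_exp: "\<And>t u. 0 \<le> t \<Longrightarrow> char (\<mu> t) u = exp (- of_real t * \<psi> u)"
begin

lemma semigroup: "0 \<le> s \<Longrightarrow> 0 \<le> t \<Longrightarrow> \<mu> (s + t) = (\<mu> s \<star> \<mu> t)"
  by (intro Levy_uniqueness distribution real_distribution_convolution ext)
    (auto simp: char_convolution distribution char_exp exp_add[symmetric] algebra_simps)

lemma char_symmetrize_exp:
  assumes "0 \<le> t"
  shows "char (symmetrize (\<mu> t)) u = of_real (exp (- 2 * t * Re (\<psi> u)))"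
proof -
  interpret real_distribution "\<mu> t" by (rule distribution) fact
  show ?thesis
    unfolding char_symmetrize by (simp add: char_exp assms power2_eq_square exp_add[symmetric])
qed

lemma symmetrize_distribution: "0 \<le> t \<Longrightarrow> real_distribution (symmetrize (\<mu> t))"
  by (intro real_distribution.real_distribution_symmetrize distribution)

lemma symmetrize_semigroup:
  assumes "0 \<le> s" "0 \<le> t"
  shows "symmetrize (\<mu> (s + t)) = (symmetrize (\<mu> s) \<star> symmetrize (\<mu> t))"
  using assms
  by (intro Levy_uniqueness symmetrize_distribution real_distribution_convolution ext)
    (auto simp: char_convolution symmetrize_distribution char_symmetrize_exp exp_add[symmetric] algebra_simps
      simp flip: of_real_mult)

lemma symmetrize_symmetric:
  assumes "0 \<le> t"
  shows "distr (symmetrize (\<mu> t)) borel uminus = symmetrize (\<mu> t)"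
proof (rule Levy_uniqueness)
  interpret real_distribution "symmetrize (\<mu> t)" by (rule symmetrize_distribution) fact
  show "real_distribution (distr (symmetrize (\<mu> t)) borel uminus)" by (rule real_distribution_uminus)
  show "real_distribution (symmetrize (\<mu> t))" ..
  show "char (distr (symmetrize (\<mu> t)) borel uminus) = char (symmetrize (\<mu> t))"
    by (rule ext) (simp add: char_uminus char_symmetrize_exp assms)
qed

text \<open>
  Superadditivity and nonnegativity make $t \<mapsto> m_t$ monotone, and $n m_t \<le> m_{nt} \<le> m_1$ whenever $n t \<le> 1$.
  For $p = 2$ the moments are additive, so that a large time can be divided into equal parts of length at most one.
\<close>
lemma symmetrized_moment_bound_ge_two:
  assumes p: "2 \<le> p" and m: "moment (symmetrize (\<mu> 1)) p < \<infinity>"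
  shows "\<exists>C\<ge>0. \<forall>t\<ge>0. t \<le> 1 \<or> p = 2 \<longrightarrow> moment (symmetrize (\<mu> t)) p \<le> ennreal (C * t)"
proof -
  define f where "f t = moment (symmetrize (\<mu> t)) p" for t
  have super: "f s + f t \<le> f (s + t)" if "0 \<le> s" "0 \<le> t" for s t
    unfolding f_def symmetrize_semigroup[OF that]
    by (intro moment_convolution_superadditive symmetrize_distribution symmetrize_symmetric that p)
  have mult: "of_nat n * f t \<le> f (of_nat n * t)" if t: "0 \<le> t" for n t
  proof (induction n)
    case (Suc n)
    have "of_nat (Suc n) * f t = f t + of_nat n * f t" by (simp add: distrib_right)
    also have "\<dots> \<le> f t + f (of_nat n * t)" using Suc by (rule add_left_mono)
    also have "\<dots> \<le> f (of_nat (Suc n) * t)" using super[of t "of_nat n * t"] t by (simp add: algebra_simps)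
    finally show ?case .
  qed simp
  have mono: "f s \<le> f t" if "0 \<le> s" "s \<le> t" for s t
  proof -
    have "f s \<le> f s + f (t - s)" by simp
    also have "\<dots> \<le> f t" using super[of s "t - s"] that by simp
    finally show ?thesis .
  qed
  obtain c where c: "0 \<le> c" "f 1 = ennreal c" using m by (cases "f 1") (auto simp: f_def)
  have small: "f t \<le> ennreal (2 * c * t)" if t: "0 \<le> t" "t \<le> 1" for t
  proof (cases "t = 0")
    case True
    have "f 0 + ennreal c \<le> 0 + ennreal c" using super[of 0 1] c by simp
    then show ?thesis using True by (simp add: ennreal_add_left_cancel_le add.commute[of _ "ennreal c"])
  next
    case False
    \<comment> \<open>The largest $n$ with $n t \<le> 1$ satisfies $n \<ge> 1/(2t)$, whence the factor two.\<close>
    define n where "n = nat \<lfloor>1 / t\<rfloor>"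
    have t0: "0 < t" using t False by simp
    have "1 \<le> 1 / t" using t t0 by simp
    then have fl: "1 \<le> \<lfloor>1 / t\<rfloor>" by (simp only: le_floor_iff of_int_1)
    have "real n = of_int \<lfloor>1 / t\<rfloor>" unfolding n_def using fl by (intro of_nat_nat) linarith
    then have n: "1 \<le> real n" "real n \<le> 1 / t" "1 / t \<le> 2 * real n"
      using fl floor_correct[of "1 / t"] by linarith+
    have nt: "real n * t \<le> 1" "1 \<le> 2 * real n * t" using n t0 by (auto simp: field_simps)
    have "ennreal (real n) * f t \<le> f (real n * t)" using mult[of t n] t by (simp add: ennreal_of_nat_eq_real_of_nat)
    also have "\<dots> \<le> ennreal c" using mono[of "real n * t" 1] nt t n c by simp
    also have "\<dots> \<le> ennreal (c * (2 * real n * t))" using c nt by (intro ennreal_leI) (simp add: mult_le_cancel_left1)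
    also have "\<dots> = ennreal (real n) * ennreal (2 * c * t)" using c t by (simp add: ennreal_mult[symmetric] mult_ac)
    finally show ?thesis using n by (subst (asm) ennreal_mult_le_mult_iff) auto
  qed
  have large: "f t \<le> ennreal (2 * c * t)" if t: "0 \<le> t" and "p = 2" for t
  proof -
    have add: "f (r + s) = f r + f s" if "0 \<le> r" "0 \<le> s" for r s
      unfolding f_def \<open>p = 2\<close> symmetrize_semigroup[OF that]
      by (intro moment_two_convolution_additive symmetrize_distribution symmetrize_symmetric that)
    have multiple: "f (of_nat (Suc n) * s) = of_nat (Suc n) * f s" if "0 \<le> s" for n s
    proof (induction n)
      case (Suc n)
      have "f (of_nat (Suc (Suc n)) * s) = f (s + of_nat (Suc n) * s)" by (simp add: algebra_simps)
      also have "\<dots> = f s + of_nat (Suc n) * f s"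
        unfolding Suc[symmetric] using that by (intro add) auto
      also have "\<dots> = of_nat (Suc (Suc n)) * f s" by (simp add: distrib_right)
      finally show ?case .
    qed simp
    define n where "n = Suc (nat \<lceil>t\<rceil>)"
    have n: "t \<le> real n" "0 < real n" unfolding n_def by - linarith+
    have "f t = f (of_nat n * (t / real n))" using n by simp
    also have "\<dots> = of_nat n * f (t / real n)" unfolding n_def using t by (intro multiple) auto
    also have "\<dots> \<le> of_nat n * ennreal (2 * c * (t / real n))"
      using t n by (intro mult_left_mono small) auto
    also have "\<dots> = ennreal (2 * c * t)"
      using n t c by (simp add: ennreal_of_nat_eq_real_of_nat ennreal_mult[symmetric])
    finally show ?thesis .
  qed
  show ?thesis using small large c unfolding f_def by (intro exI[of _ "2 * c"]) auto
qed

end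

section \<open>Doob's maximal inequality for random walks\<close>

fun running_max :: "(nat \<Rightarrow> real) \<Rightarrow> nat \<Rightarrow> real" where
  "running_max x 0 = 0"
| "running_max x (Suc k) = max (running_max x k) \<bar>\<Sum>i<Suc k. x i\<bar>"

declare running_max.simps(2) [simp del]

lemma running_max_nonneg: "0 \<le> running_max x k"
  by (induction k) (auto simp: running_max.simps(2) max_def)

lemma abs_sum_le_running_max: "k \<le> n \<Longrightarrow> \<bar>\<Sum>i<k. x i\<bar> \<le> running_max x n"
proof (induction n)
  case (Suc n)
  then show ?case by (cases "k = Suc n") (auto simp: running_max.simps(2) intro: order_trans)
qed simp

lemma running_max_cong: "(\<And>i. i < k \<Longrightarrow> x i = y i) \<Longrightarrow> running_max x k = running_max y k"
proof (induction k)
  case (Suc k)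
  have "(\<Sum>i<Suc k. x i) = (\<Sum>i<Suc k. y i)" by (rule sum.cong) (use Suc.prems in auto)
  moreover have "running_max x k = running_max y k" using Suc by simp
  ultimately show ?case by (simp only: running_max.simps(2))
qed simp

lemma measurable_running_max:
  "(\<And>i. i < k \<Longrightarrow> (\<lambda>\<omega>. x \<omega> i) \<in> borel_measurable M) \<Longrightarrow> (\<lambda>\<omega>. running_max (x \<omega>) k) \<in> borel_measurable M"
  by (induction k) (auto simp: running_max.simps(2) intro!: borel_measurable_max borel_measurable_abs borel_measurable_sum)

lemma mult_powr_le_sum:
  fixes a b p :: real
  assumes "1 \<le> p" "0 \<le> a" "0 \<le> b"
  shows "a * b powr (p - 1) \<le> a powr p + b powr p"
proof -
  define m where "m = max a b"
  have m: "0 \<le> m" "a \<le> m" "b \<le> m" using assms by (auto simp: m_def)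
  have "a * b powr (p - 1) \<le> m * m powr (p - 1)"
    using m assms by (intro mult_mono powr_mono2) auto
  also have "\<dots> = m powr p" using m by (cases "m = 0") (auto simp: powr_mult_base)
  also have "\<dots> \<le> a powr p + b powr p" by (simp add: m_def max_def)
  finally show ?thesis .
qed

text \<open>
  The function $m^p - q s m^{p-1}$ of $m$, with $q = p/(p-1)$, is decreasing on $m \<le> s$. Thus replacing the old
  maximum $m$ by the new value $s > m$ lowers it; for $s \<le> m$ nothing changes.
\<close>
lemma running_max_step:
  fixes m s p :: real
  assumes p: "1 < p" and m: "0 \<le> m" and s: "0 \<le> s"
  shows "(max m s) powr p - p / (p - 1) * (s * (max m s) powr (p - 1))
       \<le> m powr p - p / (p - 1) * (s * m powr (p - 1))"
proof (cases "s \<le> m")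
  case False
  have "s * s powr (p - 1) = s powr p" using s by (cases "s = 0") (auto simp: powr_mult_base)
  then have "(max m s) powr p - p / (p - 1) * (s * (max m s) powr (p - 1)) = s powr p - p / (p - 1) * s powr p"
    using False by (simp add: max_def)
  also have "\<dots> = - (s powr p / (p - 1))" using p by (simp add: field_simps)
  also have "\<dots> \<le> m powr p - p / (p - 1) * (s * m powr (p - 1))"
  proof -
    have "(p * s * m powr (p - 1)) / (p - 1) \<le> ((p - 1) * m powr p + s powr p) / (p - 1)"
      using young_powr[of p s m] p s m by (intro divide_right_mono) auto
    then show ?thesis using p by (simp add: add_divide_distrib mult.assoc)
  qed
  finally show ?thesis .
qed (simp add: max_def)

text \<open>
  Either $m$ is at most $2 q s$, and then the left side is at most a multiple of $s^p$, or $q s < m/2$.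
\<close>
lemma doob_absorb:
  fixes m s q p :: real
  assumes p: "1 < p" and q: "0 < q" and m: "0 \<le> m" and s: "0 \<le> s"
  shows "q * (s * m powr (p - 1)) \<le> m powr p / 2 + (2 * q) powr p * s powr p / 2"
proof (cases "m \<le> 2 * q * s")
  case True
  have "q * (s * m powr (p - 1)) \<le> q * (s * (2 * q * s) powr (p - 1))"
    using True p q m s by (intro mult_left_mono powr_mono2) auto
  also have "\<dots> = (2 * q * s) * (2 * q * s) powr (p - 1) / 2" by simp
  also have "(2 * q * s) * (2 * q * s) powr (p - 1) = (2 * q * s) powr p"
    using q s by (cases "s = 0") (auto simp: powr_mult_base)
  also have "\<dots> = (2 * q) powr p * s powr p" using q s by (simp add: powr_mult)
  finally show ?thesis by (simp add: add_increasing)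
next
  case False
  then have "q * (s * m powr (p - 1)) \<le> m / 2 * m powr (p - 1)"
    unfolding mult.assoc[symmetric] by (intro mult_right_mono) auto
  also have "m / 2 * m powr (p - 1) = m powr p / 2" using m by (cases "m = 0") (auto simp: powr_mult_base)
  finally show ?thesis by (simp add: add_increasing2)
qed

context prob_space
begin

lemma integrable_powr_add:
  fixes f g :: "'a \<Rightarrow> real"
  assumes "0 \<le> p" and [measurable]: "random_variable borel f" "random_variable borel g"
    and "integrable M (\<lambda>\<omega>. \<bar>f \<omega>\<bar> powr p)" "integrable M (\<lambda>\<omega>. \<bar>g \<omega>\<bar> powr p)"
  shows "integrable M (\<lambda>\<omega>. \<bar>f \<omega> + g \<omega>\<bar> powr p)"
proof (rule Bochner_Integration.integrable_bound)
  show "integrable M (\<lambda>\<omega>. 2 powr p * (\<bar>f \<omega>\<bar> powr p + \<bar>g \<omega>\<bar> powr p))" using assms by auto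
  show "AE \<omega> in M. norm (\<bar>f \<omega> + g \<omega>\<bar> powr p) \<le> norm (2 powr p * (\<bar>f \<omega>\<bar> powr p + \<bar>g \<omega>\<bar> powr p))"
    using powr_add_le[OF assms(1)] by (intro AE_I2) simp
qed measurable

lemma integrable_powr_imp_integrable_lower:
  fixes f :: "'a \<Rightarrow> real"
  assumes "0 \<le> r" "r \<le> p" and [measurable]: "random_variable borel f"
    and int: "integrable M (\<lambda>\<omega>. \<bar>f \<omega>\<bar> powr p)"
  shows "integrable M (\<lambda>\<omega>. \<bar>f \<omega>\<bar> powr r)"
proof (rule Bochner_Integration.integrable_bound)
  show "integrable M (\<lambda>\<omega>. 1 + \<bar>f \<omega>\<bar> powr p)" using int by auto
  have "x powr r \<le> 1 + x powr p" if "0 \<le> x" for x :: real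
  proof (cases "x \<le> 1")
    case True
    then have "x powr r \<le> 1" using that assms by (intro powr_le1) auto
    then show ?thesis by (simp add: add_increasing2)
  next
    case False
    then have "x powr r \<le> x powr p" using assms by (intro powr_mono) auto
    then show ?thesis by simp
  qed
  then show "AE \<omega> in M. norm (\<bar>f \<omega>\<bar> powr r) \<le> norm (1 + \<bar>f \<omega>\<bar> powr p)" by (intro AE_I2) simp
qed measurable

lemma integrable_of_powr:
  fixes f :: "'a \<Rightarrow> real"
  assumes "1 \<le> p" "random_variable borel f" "integrable M (\<lambda>\<omega>. \<bar>f \<omega>\<bar> powr p)"
  shows "integrable M f"
  using integrable_powr_imp_integrable_lower[of 1 p f] assms by (simp add: integrable_abs_iff)

lemma integrable_mult_powr:
  fixes f g :: "'a \<Rightarrow> real"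
  assumes "1 \<le> p" and [measurable]: "random_variable borel f" "random_variable borel g"
    and "integrable M (\<lambda>\<omega>. \<bar>f \<omega>\<bar> powr p)" "integrable M (\<lambda>\<omega>. \<bar>g \<omega>\<bar> powr p)"
  shows "integrable M (\<lambda>\<omega>. \<bar>f \<omega>\<bar> * \<bar>g \<omega>\<bar> powr (p - 1))"
proof (rule Bochner_Integration.integrable_bound)
  show "integrable M (\<lambda>\<omega>. \<bar>f \<omega>\<bar> powr p + \<bar>g \<omega>\<bar> powr p)" using assms by auto
  show "AE \<omega> in M. norm (\<bar>f \<omega>\<bar> * \<bar>g \<omega>\<bar> powr (p - 1)) \<le> norm (\<bar>f \<omega>\<bar> powr p + \<bar>g \<omega>\<bar> powr p)"
    using mult_powr_le_sum[OF assms(1)] by (intro AE_I2) (simp add: abs_mult)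
qed measurable

text \<open>
  The expectation of $R_k^p - q |S_k| R_k^{p-1}$, where $S_k$ is the partial sum and $R_k$ the running maximum, is
  nonincreasing in $k$ and starts at $0$. First $R$ is updated, which lowers the expression pathwise
  (\<open>running_max_step\<close>); then $|S_k|$ may be compared with $|S_{k+1}|$ at the old value of $R$, because $|S_k|$ is
  a submartingale and $R_k^{p-1}$ depends on the past only. The resulting estimate
  $E R_n^p \<le> q E |S_n| R_n^{p-1}$ is solved for $E R_n^p$ by absorbing half of it.
\<close>
lemma doob_maximal_inequality:
  fixes \<xi> :: "nat \<Rightarrow> 'a \<Rightarrow> real"
  assumes p: "1 < p" and indep: "indep_vars (\<lambda>_. borel) \<xi> {..<n}"
    and int: "\<And>i. i < n \<Longrightarrow> integrable M (\<lambda>\<omega>. \<bar>\<xi> i \<omega>\<bar> powr p)"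
    and mean: "\<And>i. i < n \<Longrightarrow> expectation (\<xi> i) = 0"
  shows "(\<integral>\<^sup>+\<omega>. ennreal (running_max (\<lambda>i. \<xi> i \<omega>) n powr p) \<partial>M)
    \<le> ennreal ((2 * p / (p - 1)) powr p) * (\<integral>\<^sup>+\<omega>. ennreal (\<bar>\<Sum>i<n. \<xi> i \<omega>\<bar> powr p) \<partial>M)"
proof -
  define q where "q = p / (p - 1)"
  have q: "0 < q" using p by (simp add: q_def)
  define S where "S k \<omega> = (\<Sum>i<k. \<xi> i \<omega>)" for k \<omega>
  define R where "R k \<omega> = running_max (\<lambda>i. \<xi> i \<omega>) k" for k \<omega>
  have rv: "random_variable borel (\<xi> i)" if "i < n" for i
    using indep that unfolding indep_vars_def by auto
  have S_rv: "random_variable borel (S k)" if "k \<le> n" for k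
    unfolding S_def[abs_def] using rv that by (intro borel_measurable_sum) auto
  have R_rv: "random_variable borel (R k)" if "k \<le> n" for k
    unfolding R_def[abs_def] using rv that by (intro measurable_running_max) auto
  have R0: "0 \<le> R k \<omega>" for k \<omega> by (simp add: R_def running_max_nonneg)
  have S_Suc: "S (Suc k) \<omega> = S k \<omega> + \<xi> k \<omega>" for k \<omega> by (simp add: S_def)
  have R_Suc: "R (Suc k) \<omega> = max (R k \<omega>) \<bar>S (Suc k) \<omega>\<bar>" for k \<omega>
    by (simp only: R_def running_max.simps(2) S_def)
  have S_int: "integrable M (\<lambda>\<omega>. \<bar>S k \<omega>\<bar> powr p)" if "k \<le> n" for k
    using that
  proof (induction k)
    case (Suc k)
    then show ?case unfolding S_Suc
      using p rv S_rv int by (intro integrable_powr_add) auto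
  qed (simp add: S_def)
  have R_int: "integrable M (\<lambda>\<omega>. \<bar>R k \<omega>\<bar> powr p)" if "k \<le> n" for k
    using that
  proof (induction k)
    case (Suc k)
    show ?case
    proof (rule Bochner_Integration.integrable_bound)
      show "integrable M (\<lambda>\<omega>. \<bar>R k \<omega>\<bar> powr p + \<bar>S (Suc k) \<omega>\<bar> powr p)" using Suc S_int by auto
      show "(\<lambda>\<omega>. \<bar>R (Suc k) \<omega>\<bar> powr p) \<in> borel_measurable M" using R_rv[OF Suc.prems] by measurable
      show "AE \<omega> in M. norm (\<bar>R (Suc k) \<omega>\<bar> powr p) \<le> norm (\<bar>R k \<omega>\<bar> powr p + \<bar>S (Suc k) \<omega>\<bar> powr p)"
        using R0 by (intro AE_I2) (auto simp: R_Suc max_def)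
    qed
  qed (simp add: R_def)
  have SR_int: "integrable M (\<lambda>\<omega>. \<bar>S j \<omega>\<bar> * R k \<omega> powr (p - 1))" if "j \<le> n" "k \<le> n" for j k
    using integrable_mult_powr[of p "S j" "R k"] p that S_rv R_rv S_int R_int R0 by simp
  have R_int': "integrable M (\<lambda>\<omega>. R k \<omega> powr p)" if "k \<le> n" for k
    using R_int[OF that] R0 by simp
  have W_int: "integrable M (\<lambda>\<omega>. R k \<omega> powr (p - 1))" if "k \<le> n" for k
    using integrable_powr_imp_integrable_lower[of "p - 1" p "R k"] p R_rv R_int R0 that by simp
  have submart: "expectation (\<lambda>\<omega>. \<bar>S k \<omega>\<bar> * R k \<omega> powr (p - 1))
      \<le> expectation (\<lambda>\<omega>. \<bar>S (Suc k) \<omega>\<bar> * R k \<omega> powr (p - 1))" if k: "k < n" for k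
  proof -
    \<comment> \<open>$|S_k + \xi_k| \<ge> |S_k| + sgn(S_k) \xi_k$, and the last term, weighted by the past, has mean zero by independence.\<close>
    define V where "V \<omega> = sgn (S k \<omega>) * R k \<omega> powr (p - 1)" for \<omega>
    have V_int: "integrable M V"
    proof (rule Bochner_Integration.integrable_bound[OF W_int[of k]])
      have [measurable]: "S k \<in> borel_measurable M" "R k \<in> borel_measurable M"
        using S_rv[of k] R_rv[of k] k by auto
      show "V \<in> borel_measurable M" unfolding V_def[abs_def] by measurable
    qed (use k in \<open>auto simp: V_def abs_mult sgn_if\<close>)
    have \<xi>_int: "integrable M (\<xi> k)" using integrable_of_powr[OF _ rv[OF k] int[OF k]] p by simp
    have "indep_var (PiM {..<k} (\<lambda>_. borel)) (\<lambda>\<omega>. restrict (\<lambda>i. \<xi> i \<omega>) {..<k})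
        (PiM {k} (\<lambda>_. borel)) (\<lambda>\<omega>. restrict (\<lambda>i. \<xi> i \<omega>) {k})"
      using k by (intro indep_var_restrict[OF indep]) auto
    then have "indep_var borel ((\<lambda>x. sgn (\<Sum>i<k. x i) * running_max x k powr (p - 1)) \<circ>
          (\<lambda>\<omega>. restrict (\<lambda>i. \<xi> i \<omega>) {..<k}))
        borel ((\<lambda>x. x k) \<circ> (\<lambda>\<omega>. restrict (\<lambda>i. \<xi> i \<omega>) {k}))"
    proof (rule indep_var_compose)
      have [measurable]: "(\<lambda>x. running_max x k) \<in> borel_measurable (PiM {..<k} (\<lambda>_. borel))"
        by (intro measurable_running_max measurable_component_singleton) auto
      have [measurable]: "(\<lambda>x. \<Sum>i<k. x i) \<in> borel_measurable (PiM {..<k} (\<lambda>_. borel :: real measure))"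
        by (intro borel_measurable_sum measurable_component_singleton) auto
      show "(\<lambda>x. sgn (\<Sum>i<k. x i) * running_max x k powr (p - 1)) \<in> borel_measurable (PiM {..<k} (\<lambda>_. borel))"
        by measurable
      show "(\<lambda>x. x k) \<in> borel_measurable (PiM {k} (\<lambda>_. borel))"
        by (intro measurable_component_singleton) auto
    qed
    moreover have "(\<lambda>x. sgn (\<Sum>i<k. x i) * running_max x k powr (p - 1)) \<circ>
          (\<lambda>\<omega>. restrict (\<lambda>i. \<xi> i \<omega>) {..<k}) = V"
    proof (rule ext)
      fix \<omega>
      have "running_max (restrict (\<lambda>i. \<xi> i \<omega>) {..<k}) k = R k \<omega>"
        unfolding R_def by (rule running_max_cong) simp
      then show "((\<lambda>x. sgn (\<Sum>i<k. x i) * running_max x k powr (p - 1)) \<circ>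
          (\<lambda>\<omega>. restrict (\<lambda>i. \<xi> i \<omega>) {..<k})) \<omega> = V \<omega>"
        by (simp add: V_def S_def)
    qed
    moreover have "(\<lambda>x. x k) \<circ> (\<lambda>\<omega>. restrict (\<lambda>i. \<xi> i \<omega>) {k}) = \<xi> k" by (auto simp: fun_eq_iff)
    ultimately have "indep_var borel V borel (\<xi> k)" by simp
    note V\<xi> = indep_var_lebesgue_integral[OF this V_int \<xi>_int] indep_var_integrable[OF this V_int \<xi>_int]
    have "expectation (\<lambda>\<omega>. \<bar>S k \<omega>\<bar> * R k \<omega> powr (p - 1))
        = expectation (\<lambda>\<omega>. \<bar>S k \<omega>\<bar> * R k \<omega> powr (p - 1) + V \<omega> * \<xi> k \<omega>)"
      using V\<xi> SR_int[of k k] k mean by simp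
    also have "\<dots> \<le> expectation (\<lambda>\<omega>. \<bar>S (Suc k) \<omega>\<bar> * R k \<omega> powr (p - 1))"
    proof (rule integral_mono)
      fix \<omega>
      have "\<bar>S k \<omega>\<bar> + sgn (S k \<omega>) * \<xi> k \<omega> \<le> \<bar>S (Suc k) \<omega>\<bar>" unfolding S_Suc by (auto simp: sgn_if)
      then have "(\<bar>S k \<omega>\<bar> + sgn (S k \<omega>) * \<xi> k \<omega>) * R k \<omega> powr (p - 1) \<le> \<bar>S (Suc k) \<omega>\<bar> * R k \<omega> powr (p - 1)"
        by (intro mult_right_mono) auto
      then show "\<bar>S k \<omega>\<bar> * R k \<omega> powr (p - 1) + V \<omega> * \<xi> k \<omega> \<le> \<bar>S (Suc k) \<omega>\<bar> * R k \<omega> powr (p - 1)"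
        by (simp add: V_def algebra_simps)
    qed (use V\<xi> SR_int k in auto)
    finally show ?thesis .
  qed
  have key: "expectation (\<lambda>\<omega>. R k \<omega> powr p) \<le> q * expectation (\<lambda>\<omega>. \<bar>S k \<omega>\<bar> * R k \<omega> powr (p - 1))"
    if "k \<le> n" for k
    using that
  proof (induction k)
    case (Suc k)
    have k: "k < n" "k \<le> n" using Suc by auto
    have "expectation (\<lambda>\<omega>. R (Suc k) \<omega> powr p) - q * expectation (\<lambda>\<omega>. \<bar>S (Suc k) \<omega>\<bar> * R (Suc k) \<omega> powr (p - 1))
       = expectation (\<lambda>\<omega>. R (Suc k) \<omega> powr p - q * (\<bar>S (Suc k) \<omega>\<bar> * R (Suc k) \<omega> powr (p - 1)))"
      using R_int'[OF Suc.prems] SR_int[OF Suc.prems Suc.prems] by simp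
    also have "\<dots> \<le> expectation (\<lambda>\<omega>. R k \<omega> powr p - q * (\<bar>S (Suc k) \<omega>\<bar> * R k \<omega> powr (p - 1)))"
    proof (rule integral_mono)
      show "R (Suc k) \<omega> powr p - q * (\<bar>S (Suc k) \<omega>\<bar> * R (Suc k) \<omega> powr (p - 1))
          \<le> R k \<omega> powr p - q * (\<bar>S (Suc k) \<omega>\<bar> * R k \<omega> powr (p - 1))" for \<omega>
        unfolding R_Suc q_def by (intro running_max_step p R0) simp
    qed (use R_int' SR_int Suc.prems k in auto)
    also have "\<dots> = expectation (\<lambda>\<omega>. R k \<omega> powr p) - q * expectation (\<lambda>\<omega>. \<bar>S (Suc k) \<omega>\<bar> * R k \<omega> powr (p - 1))"
      using R_int'[OF k(2)] SR_int[OF Suc.prems k(2)] by simp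
    also have "\<dots> \<le> 0"
      using order_trans[OF Suc.IH[OF k(2)] mult_left_mono[OF submart[OF k(1)], of q]] q by simp
    finally show ?case by simp
  qed (simp add: R_def)
  have "expectation (\<lambda>\<omega>. R n \<omega> powr p) \<le> expectation (\<lambda>\<omega>. q * (\<bar>S n \<omega>\<bar> * R n \<omega> powr (p - 1)))"
    using key[of n] by simp
  also have "\<dots> \<le> expectation (\<lambda>\<omega>. R n \<omega> powr p / 2 + (2 * q) powr p * \<bar>S n \<omega>\<bar> powr p / 2)"
    using R_int'[of n] SR_int[of n n] S_int[of n] R0 p q
    by (intro integral_mono doob_absorb integrable_mult_right) auto
  also have "\<dots> = expectation (\<lambda>\<omega>. R n \<omega> powr p) / 2 + (2 * q) powr p * expectation (\<lambda>\<omega>. \<bar>S n \<omega>\<bar> powr p) / 2"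
    using R_int'[of n] S_int[of n] by simp
  finally have "expectation (\<lambda>\<omega>. R n \<omega> powr p) \<le> (2 * q) powr p * expectation (\<lambda>\<omega>. \<bar>S n \<omega>\<bar> powr p)" by simp
  then have "ennreal (expectation (\<lambda>\<omega>. R n \<omega> powr p))
      \<le> ennreal ((2 * q) powr p) * ennreal (expectation (\<lambda>\<omega>. \<bar>S n \<omega>\<bar> powr p))"
    by (simp add: ennreal_mult'[symmetric] ennreal_leI)
  then show ?thesis
    using R_int'[of n] S_int[of n] by (simp add: nn_integral_eq_integral R_def S_def q_def)
qed

end

section \<open>Suprema along dyadic grids\<close>

lemma powr_add_le_sum_powr:
  fixes a b p :: real
  assumes p: "0 < p" "p \<le> 1" and a: "0 \<le> a" and b: "0 \<le> b"
  shows "(a + b) powr p \<le> a powr p + b powr p"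
proof (cases "a + b = 0")
  case False
  then have ab: "0 < a + b" using a b by simp
  have *: "x * (a + b) powr (p - 1) \<le> x powr p" if "0 \<le> x" "x \<le> a + b" for x
  proof (cases "x = 0")
    case False
    then have "x * (a + b) powr (p - 1) \<le> x * x powr (p - 1)"
      using that p by (intro mult_left_mono powr_mono2') auto
    then show ?thesis using False that by (simp add: powr_mult_base)
  qed simp
  have "(a + b) powr p = (a + b) * (a + b) powr (p - 1)" using ab by (simp add: powr_mult_base)
  also have "\<dots> \<le> a powr p + b powr p" using *[of a] *[of b] a b by (simp add: distrib_right)
  finally show ?thesis .
qed (use a b in simp)

lemma abs_sum_powr_le:
  fixes x :: "nat \<Rightarrow> real"
  assumes p: "0 < p" "p \<le> 1"
  shows "\<bar>\<Sum>i<k. x i\<bar> powr p \<le> (\<Sum>i<k. \<bar>x i\<bar> powr p)"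
proof (induction k)
  case (Suc k)
  have "\<bar>\<Sum>i<Suc k. x i\<bar> powr p \<le> (\<bar>\<Sum>i<k. x i\<bar> + \<bar>x k\<bar>) powr p"
    using p by (intro powr_mono2) auto
  also have "\<dots> \<le> \<bar>\<Sum>i<k. x i\<bar> powr p + \<bar>x k\<bar> powr p" using p by (intro powr_add_le_sum_powr) auto
  finally show ?case using Suc by simp
qed simp

text \<open>
  Every time before $t$ is a limit of dyadic multiples of $t$ from the right, and right-continuity carries the value
  of the path along. The endpoint $t$ belongs to all grids.
\<close>
lemma cadlag_sup_le_dyadic_sup:
  fixes f :: "real \<Rightarrow> real"
  assumes f: "cadlag f" and t: "0 < t" and p: "0 < p"
  shows "(SUP s\<in>{0..t}. ennreal (\<bar>f s - s * c\<bar> powr p))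
    \<le> (SUP n. SUP k\<in>{..2^n}. ennreal (\<bar>f (real k * (t / 2^n)) - real k * (t / 2^n) * c\<bar> powr p))"
    (is "_ \<le> ?R")
proof (rule SUP_least)
  define g where "g s = ennreal (\<bar>f s - s * c\<bar> powr p)" for s
  have grid: "g (real k * (t / 2^n)) \<le> ?R" if "k \<le> 2^n" for k n
    unfolding g_def using that
    by (intro SUP_upper2[of n] SUP_upper2[of k]) auto
  fix s assume s: "s \<in> {0..t}"
  show "ennreal (\<bar>f s - s * c\<bar> powr p) \<le> ?R"
  proof (cases "s = t")
    case True
    then show ?thesis using grid[of 1 0] by (simp add: g_def)
  next
    case False
    \<comment> \<open>The first grid point strictly to the right of $s$.\<close>
    define k where "k n = Suc (nat \<lfloor>s * 2^n / t\<rfloor>)" for n :: nat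
    define r where "r n = real (k n) * (t / 2^n)" for n
    have k: "s * 2^n / t < real (k n)" "real (k n) \<le> s * 2^n / t + 1" "k n \<le> 2^n" for n
    proof -
      have fl: "0 \<le> \<lfloor>s * 2^n / t\<rfloor>" using s t by simp
      have eq: "real (k n) = of_int \<lfloor>s * 2^n / t\<rfloor> + 1" unfolding k_def using of_nat_nat[OF fl] by simp
      show "s * 2^n / t < real (k n)" "real (k n) \<le> s * 2^n / t + 1"
        using eq floor_correct[of "s * 2^n / t"] by linarith+
      have "s * 2^n / t < 2^n" using s False t by (simp add: field_simps)
      then have "\<lfloor>s * 2^n / t\<rfloor> < 2^n" by (simp add: floor_less_iff)
      then have "nat \<lfloor>s * 2^n / t\<rfloor> < 2^n" using fl by (subst nat_less_iff) auto
      then show "k n \<le> 2^n" by (simp only: k_def Suc_le_eq)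
    qed
    have r: "s < r n" "r n \<le> s + t / 2^n" for n
    proof -
      define y :: real where "y = t / 2^n"
      have y: "0 < y" "s * 2^n / t = s / y" using t by (auto simp: y_def)
      show "s < r n" using k(1)[of n] y by (simp add: r_def y_def[symmetric] pos_divide_less_eq)
      have "real (k n) * y \<le> (s / y + 1) * y" using k(2)[of n] y by (intro mult_right_mono) auto
      also have "\<dots> = s + y" using y by (simp add: distrib_right)
      finally show "r n \<le> s + t / 2^n" by (simp add: r_def y_def)
    qed
    have "(\<lambda>n. s + t * inverse (2^n)) \<longlonglongrightarrow> s + t * 0"
      by (intro tendsto_intros LIMSEQ_inverse_realpow_zero) simp
    then have r_lim: "r \<longlonglongrightarrow> s"
      using r by (intro tendsto_sandwich[of "\<lambda>_. s" r sequentially "\<lambda>n. s + t / 2^n"])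
        (auto intro!: always_eventually less_imp_le simp: divide_inverse)
    have "filterlim r (at_right s) sequentially"
      using r_lim r(1) by (auto simp: filterlim_at intro!: always_eventually less_imp_neq[symmetric])
    moreover have "(f \<longlongrightarrow> f s) (at_right s)" using f s by (auto simp: cadlag_def)
    ultimately have "(\<lambda>n. f (r n)) \<longlonglongrightarrow> f s" by (rule filterlim_compose[rotated])
    then have "(\<lambda>n. g (r n)) \<longlonglongrightarrow> g s"
      unfolding g_def using r_lim p by (intro tendsto_ennrealI tendsto_powr' tendsto_intros) auto
    then have "g s \<le> ?R"
      using grid k(3) by (intro LIMSEQ_le_const2[of "\<lambda>n. g (r n)"]) (auto simp: r_def)
    then show ?thesis by (simp add: g_def)
  qed
qed

context levy_process
begin

definition grid_sup :: "real \<Rightarrow> real \<Rightarrow> real \<Rightarrow> nat \<Rightarrow> 'a \<Rightarrow> ennreal" where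
  "grid_sup c p h N \<omega> = (SUP k\<in>{..N}. ennreal (\<bar>X (real k * h) \<omega> - real k * h * c\<bar> powr p))"

lemma measurable_grid_sup:
  assumes h: "0 \<le> h"
  shows "grid_sup c p h N \<in> borel_measurable M"
  unfolding grid_sup_def[abs_def]
proof (rule borel_measurable_SUP)
  fix k
  have [measurable]: "random_variable borel (X (real k * h))" using h by (intro rv) simp
  show "(\<lambda>\<omega>. ennreal (\<bar>X (real k * h) \<omega> - real k * h * c\<bar> powr p)) \<in> borel_measurable M" by measurable
qed simp

text \<open>
  The dyadic grids are nested, so monotone convergence applies to their maxima, whose limit bounds the supremum
  over the whole interval almost surely.
\<close>
lemma sup_moment_le_grid:
  assumes t: "0 < t" and p: "0 < p"
    and le: "\<And>n. (\<integral>\<^sup>+\<omega>. grid_sup c p (t / 2^n) (2^n) \<omega> \<partial>M) \<le> B"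
  shows "sup_moment M (\<lambda>s \<omega>. X s \<omega> - s * c) p t \<le> B"
proof -
  define D where "D n = grid_sup c p (t / 2^n) (2^n)" for n
  have "sup_moment M (\<lambda>s \<omega>. X s \<omega> - s * c) p t \<le> (\<integral>\<^sup>+\<omega>. (SUP n. D n \<omega>) \<partial>M)"
    unfolding sup_moment_def
  proof (rule nn_integral_mono_AE)
    show "AE \<omega> in M. (SUP s\<in>{0..t}. ennreal (\<bar>X s \<omega> - s * c\<bar> powr p)) \<le> (SUP n. D n \<omega>)"
      using cadlag_paths
      by eventually_elim (use cadlag_sup_le_dyadic_sup[OF _ t p] in \<open>simp add: D_def grid_sup_def\<close>)
  qed
  also have "\<dots> = (SUP n. \<integral>\<^sup>+\<omega>. D n \<omega> \<partial>M)"
  proof (rule nn_integral_monotone_convergence_SUP)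
    show "incseq D"
    proof (rule incseq_SucI, rule le_funI)
      fix n \<omega>
      show "D n \<omega> \<le> D (Suc n) \<omega>"
        unfolding D_def grid_sup_def
      proof (rule SUP_mono)
        fix k :: nat assume "k \<in> {..2^n}"
        then show "\<exists>m\<in>{..2 ^ Suc n}. ennreal (\<bar>X (real k * (t / 2 ^ n)) \<omega> - real k * (t / 2 ^ n) * c\<bar> powr p)
            \<le> ennreal (\<bar>X (real m * (t / 2 ^ Suc n)) \<omega> - real m * (t / 2 ^ Suc n) * c\<bar> powr p)"
          by (intro bexI[of _ "2 * k"]) auto
      qed
    qed
    show "D n \<in> borel_measurable M" for n unfolding D_def using t by (intro measurable_grid_sup) simp
  qed
  also have "\<dots> \<le> B" using le by (intro SUP_least) (simp add: D_def)
  finally show ?thesis .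
qed

lemma sup_moment_zero: "sup_moment M (\<lambda>s \<omega>. X s \<omega> - s * c) p 0 = 0"
proof -
  have "sup_moment M (\<lambda>s \<omega>. X s \<omega> - s * c) p 0 \<le> (\<integral>\<^sup>+\<omega>. 0 \<partial>M)"
    unfolding sup_moment_def
    by (rule nn_integral_mono_AE) (use start_zero in \<open>eventually_elim, simp\<close>)
  then show ?thesis by simp
qed

definition increment :: "real \<Rightarrow> real \<Rightarrow> nat \<Rightarrow> 'a \<Rightarrow> real" where
  "increment c h i \<omega> = X (real (Suc i) * h) \<omega> - X (real i * h) \<omega> - h * c"

lemma increment_rv: "0 \<le> h \<Longrightarrow> random_variable borel (increment c h i)"
  unfolding increment_def[abs_def] using rv[of "real (Suc i) * h"] rv[of "real i * h"] by measurable

lemma distr_increment: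
  assumes h: "0 \<le> h"
  shows "distr M borel (increment c h i) = distr M borel (\<lambda>\<omega>. X h \<omega> - h * c)"
proof -
  have [measurable]: "random_variable borel (X (real i * h))" "random_variable borel (X h)"
    "random_variable borel (X (real i * h + h))" using h by (auto intro!: rv)
  have "distr M borel (increment c h i)
      = distr (distr M borel (\<lambda>\<omega>. X (real i * h + h) \<omega> - X (real i * h) \<omega>)) borel (\<lambda>x. x - h * c)"
  proof -
    have "real (Suc i) * h = real i * h + h" by (simp add: algebra_simps)
    then show ?thesis unfolding increment_def[abs_def] by (subst distr_distr) (simp_all add: o_def)
  qed
  also have "\<dots> = distr (distr M borel (X h)) borel (\<lambda>x. x - h * c)"
    using stationary_increments[of "real i * h" h] h by simp
  also have "\<dots> = distr M borel (\<lambda>\<omega>. X h \<omega> - h * c)"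
    by (subst distr_distr) (auto simp: o_def)
  finally show ?thesis .
qed

lemma nn_integral_increment:
  assumes h: "0 \<le> h"
  shows "(\<integral>\<^sup>+\<omega>. ennreal (\<bar>increment c h i \<omega>\<bar> powr p) \<partial>M) = (\<integral>\<^sup>+\<omega>. ennreal (\<bar>X h \<omega> - h * c\<bar> powr p) \<partial>M)"
proof -
  have [measurable]: "random_variable borel (increment c h i)" "random_variable borel (X h)"
    using h by (auto intro: rv increment_rv)
  have "(\<integral>\<^sup>+\<omega>. ennreal (\<bar>increment c h i \<omega>\<bar> powr p) \<partial>M)
      = (\<integral>\<^sup>+x. ennreal (\<bar>x\<bar> powr p) \<partial>distr M borel (increment c h i))"
    by (subst nn_integral_distr) auto
  also have "\<dots> = (\<integral>\<^sup>+\<omega>. ennreal (\<bar>X h \<omega> - h * c\<bar> powr p) \<partial>M)"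
    unfolding distr_increment[OF h] by (subst nn_integral_distr) auto
  finally show ?thesis .
qed

lemma indep_vars_increment:
  assumes h: "0 < h"
  shows "indep_vars (\<lambda>_. borel) (increment c h) {..<n}"
proof -
  have "indep_vars (\<lambda>_. borel) (\<lambda>i \<omega>. X (real (Suc i) * h) \<omega> - X (real i * h) \<omega>) {..<n}"
    using h by (intro indep_increments) auto
  from indep_vars_compose2[OF this, of "\<lambda>_ x. x - h * c" "\<lambda>_. borel"]
  show ?thesis by (simp add: increment_def[abs_def])
qed

lemma sum_increment: "(\<Sum>i<k. increment c h i \<omega>) = X (real k * h) \<omega> - X 0 \<omega> - real k * h * c"
  by (induction k) (auto simp: increment_def algebra_simps)

text \<open>
  For $p \<le> 1$ the maximum of $|S_k|^p$ is at most the sum of the $|\xi_i|^p$, by subadditivity. This crude bound is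
  sharp enough because each increment will contribute $O(h)$.
\<close>
lemma grid_sup_moment_le_sum:
  assumes h: "0 \<le> h" and p: "0 < p" "p \<le> 1"
  shows "(\<integral>\<^sup>+\<omega>. grid_sup c p h N \<omega> \<partial>M) \<le> of_nat N * (\<integral>\<^sup>+\<omega>. ennreal (\<bar>X h \<omega> - h * c\<bar> powr p) \<partial>M)"
proof -
  have [measurable]: "random_variable borel (increment c h i)" for i using h by (rule increment_rv)
  have "(\<integral>\<^sup>+\<omega>. grid_sup c p h N \<omega> \<partial>M) \<le> (\<integral>\<^sup>+\<omega>. (\<Sum>i<N. ennreal (\<bar>increment c h i \<omega>\<bar> powr p)) \<partial>M)"
  proof (rule nn_integral_mono_AE)
    show "AE \<omega> in M. grid_sup c p h N \<omega> \<le> (\<Sum>i<N. ennreal (\<bar>increment c h i \<omega>\<bar> powr p))"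
      using start_zero
    proof eventually_elim
      fix \<omega> assume X0: "X 0 \<omega> = 0"
      show "grid_sup c p h N \<omega> \<le> (\<Sum>i<N. ennreal (\<bar>increment c h i \<omega>\<bar> powr p))"
        unfolding grid_sup_def
      proof (rule SUP_least)
        fix k assume k: "k \<in> {..N}"
        have "\<bar>X (real k * h) \<omega> - real k * h * c\<bar> powr p \<le> (\<Sum>i<k. \<bar>increment c h i \<omega>\<bar> powr p)"
          using abs_sum_powr_le[OF p, of "\<lambda>i. increment c h i \<omega>" k] by (simp add: sum_increment X0)
        also have "\<dots> \<le> (\<Sum>i<N. \<bar>increment c h i \<omega>\<bar> powr p)" using k by (intro sum_mono2) auto
        finally show "ennreal (\<bar>X (real k * h) \<omega> - real k * h * c\<bar> powr p) \<le> (\<Sum>i<N. ennreal (\<bar>increment c h i \<omega>\<bar> powr p))"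
          by (simp add: ennreal_leI)
      qed
    qed
  qed
  also have "\<dots> = of_nat N * (\<integral>\<^sup>+\<omega>. ennreal (\<bar>X h \<omega> - h * c\<bar> powr p) \<partial>M)"
    by (subst nn_integral_sum) (auto simp: nn_integral_increment[OF h])
  finally show ?thesis .
qed

lemma grid_sup_moment_le_doob:
  assumes h: "0 < h" and p: "1 < p" and mean: "expectation (X h) = h * c"
    and fin: "(\<integral>\<^sup>+\<omega>. ennreal (\<bar>X h \<omega> - h * c\<bar> powr p) \<partial>M) < \<infinity>"
  shows "(\<integral>\<^sup>+\<omega>. grid_sup c p h N \<omega> \<partial>M) \<le> ennreal ((2 * p / (p - 1)) powr p) *
    (\<integral>\<^sup>+\<omega>. ennreal (\<bar>X (real N * h) \<omega> - real N * h * c\<bar> powr p) \<partial>M)"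
proof -
  have h0: "0 \<le> h" using h by simp
  have inc [measurable]: "random_variable borel (increment c h i)" for i using h0 by (rule increment_rv)
  have Xh [measurable]: "random_variable borel (X h)" using h0 by (rule rv)
  have int: "integrable M (\<lambda>\<omega>. \<bar>increment c h i \<omega>\<bar> powr p)" for i
  proof (rule integrableI_nonneg)
    show "(\<integral>\<^sup>+\<omega>. ennreal (\<bar>increment c h i \<omega>\<bar> powr p) \<partial>M) < \<infinity>"
      using fin by (simp only: nn_integral_increment[OF h0])
  qed auto
  have Xint: "integrable M (\<lambda>\<omega>. X h \<omega> - h * c)"
  proof (rule integrable_of_powr)
    show "integrable M (\<lambda>\<omega>. \<bar>X h \<omega> - h * c\<bar> powr p)" using fin by (intro integrableI_nonneg) auto
  qed (use p in auto)
  have "expectation (increment c h i) = 0" for i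
  proof -
    have "expectation (increment c h i) = (LINT x|distr M borel (increment c h i). x)"
      by (subst integral_distr) auto
    also have "\<dots> = expectation (\<lambda>\<omega>. X h \<omega> - h * c)"
      unfolding distr_increment[OF h0] by (subst integral_distr) auto
    also have "\<dots> = 0"
      using Bochner_Integration.integrable_add[OF Xint, of "\<lambda>_. h * c"] mean prob_space by simp
    finally show ?thesis .
  qed
  note doob = doob_maximal_inequality[OF p indep_vars_increment[OF h, of c N] int this]
  have "(\<integral>\<^sup>+\<omega>. grid_sup c p h N \<omega> \<partial>M) \<le> (\<integral>\<^sup>+\<omega>. ennreal (running_max (\<lambda>i. increment c h i \<omega>) N powr p) \<partial>M)"
  proof (rule nn_integral_mono_AE)
    show "AE \<omega> in M. grid_sup c p h N \<omega> \<le> ennreal (running_max (\<lambda>i. increment c h i \<omega>) N powr p)"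
      using start_zero
    proof eventually_elim
      fix \<omega> assume X0: "X 0 \<omega> = 0"
      show "grid_sup c p h N \<omega> \<le> ennreal (running_max (\<lambda>i. increment c h i \<omega>) N powr p)"
        unfolding grid_sup_def
      proof (rule SUP_least)
        fix k assume "k \<in> {..N}"
        then show "ennreal (\<bar>X (real k * h) \<omega> - real k * h * c\<bar> powr p) \<le> ennreal (running_max (\<lambda>i. increment c h i \<omega>) N powr p)"
          using abs_sum_le_running_max[of k N "\<lambda>i. increment c h i \<omega>"] p
          by (intro ennreal_leI powr_mono2) (auto simp: sum_increment X0)
      qed
    qed
  qed
  also note doob
  also have "(\<integral>\<^sup>+\<omega>. ennreal (\<bar>\<Sum>i<N. increment c h i \<omega>\<bar> powr p) \<partial>M)
      = (\<integral>\<^sup>+\<omega>. ennreal (\<bar>X (real N * h) \<omega> - real N * h * c\<bar> powr p) \<partial>M)"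
    by (rule nn_integral_cong_AE) (use start_zero in \<open>eventually_elim, simp add: sum_increment\<close>)
  finally show ?thesis .
qed

end

section \<open>Moment estimates for Levy processes\<close>

text \<open>
  If $p$ exceeds the index, some smaller exponent $q$ has a finite moment, and $|x|^p \<le> |x|^q$ for $|x| \<le> 1$.
\<close>
lemma small_jump_moment_finite:
  assumes \<nu>: "levy_measure \<nu>"
    and p: "levy_index \<nu> < p \<or>
         (p = levy_index \<nu> \<and> 0 < levy_index \<nu> \<and> small_jump_moment \<nu> (levy_index \<nu>) < \<infinity>)"
  shows "small_jump_moment \<nu> p < \<infinity>"
  using p
proof
  assume "levy_index \<nu> < p"
  have "small_jump_moment \<nu> 2 \<le> (\<integral>\<^sup>+x. ennreal (min (x\<^sup>2) 1) \<partial>\<nu>)"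
    unfolding small_jump_moment_def
    by (intro nn_integral_mono) (auto split: split_indicator simp: abs_square_le_1 intro!: ennreal_leI)
  also have "\<dots> < \<infinity>" using \<nu> by (simp add: levy_measure_def)
  finally have "2 \<in> {p. 0 < p \<and> small_jump_moment \<nu> p < \<infinity>}" by simp
  then obtain q where q: "small_jump_moment \<nu> q < \<infinity>" "q < p"
    using cInf_lessD[OF _ \<open>levy_index \<nu> < p\<close>[unfolded levy_index_def]] by blast
  have "small_jump_moment \<nu> p \<le> small_jump_moment \<nu> q"
    unfolding small_jump_moment_def
  proof (intro nn_integral_mono)
    fix x :: real
    have "\<bar>x\<bar> powr p \<le> \<bar>x\<bar> powr q" if "\<bar>x\<bar> \<le> 1"
      using powr_mono'[of q p "\<bar>x\<bar>"] that q by (cases "x = 0") auto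
    then show "ennreal (\<bar>x\<bar> powr p) * indicator {x. \<bar>x\<bar> \<le> 1} x \<le> ennreal (\<bar>x\<bar> powr q) * indicator {x. \<bar>x\<bar> \<le> 1} x"
      by (auto split: split_indicator intro: ennreal_leI)
  qed
  then show ?thesis using q(1) by simp
qed auto

context levy_process
begin

abbreviation law :: "real \<Rightarrow> real measure" where
  "law t \<equiv> distr M borel (X t)"

lemma law_distribution: "0 \<le> t \<Longrightarrow> real_distribution (law t)"
  using rv by (rule real_distribution_distr)

lemma moment_law:
  assumes "0 \<le> t"
  shows "moment (law t) p = (\<integral>\<^sup>+\<omega>. ennreal (\<bar>X t \<omega>\<bar> powr p) \<partial>M)"
  unfolding moment_def using rv[OF assms] by (subst nn_integral_distr) auto

lemma increment_integral:
  assumes st: "0 \<le> s" "0 \<le> t"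
  shows "integrable M (\<lambda>\<omega>. X (s + t) \<omega> - X s \<omega>) \<longleftrightarrow> integrable M (X t)"
    and "expectation (\<lambda>\<omega>. X (s + t) \<omega> - X s \<omega>) = expectation (X t)"
proof -
  have [measurable]: "random_variable borel (X s)" "random_variable borel (X t)" "random_variable borel (X (s + t))"
    using st by (auto intro: rv)
  have "integrable (distr M borel (\<lambda>\<omega>. X (s + t) \<omega> - X s \<omega>)) (\<lambda>x. x) \<longleftrightarrow> integrable (law t) (\<lambda>x. x)"
    by (simp add: stationary_increments[OF st])
  then show "integrable M (\<lambda>\<omega>. X (s + t) \<omega> - X s \<omega>) \<longleftrightarrow> integrable M (X t)"
    by (simp add: integrable_distr_eq)
  have "(LINT x|distr M borel (\<lambda>\<omega>. X (s + t) \<omega> - X s \<omega>). x) = (LINT x|law t. x)"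
    by (simp add: stationary_increments[OF st])
  then show "expectation (\<lambda>\<omega>. X (s + t) \<omega> - X s \<omega>) = expectation (X t)"
    by (simp add: integral_distr)
qed

text \<open>
  Integer times are sums of increments distributed as $X_1$. An earlier time $t \<le> n$ is reached because $X_n$ is the
  sum of $X_t$ and an independent variable.
\<close>
lemma integrable_all_times:
  assumes semi: "char_semigroup law \<psi>" and int1: "integrable M (X 1)" and t: "0 \<le> t"
  shows "integrable M (X t)"
proof -
  interpret char_semigroup law \<psi> by fact
  have nat: "integrable M (X (real n))" for n
  proof (induction n)
    case 0
    have [measurable]: "random_variable borel (X 0)" by (rule rv) simp
    have "integrable M (X 0) \<longleftrightarrow> integrable M (\<lambda>_. 0 :: real)"
      using start_zero by (intro integrable_cong_AE) auto
    then show ?case by simp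
  next
    case (Suc n)
    have "integrable M (\<lambda>\<omega>. X (real n + 1) \<omega> - X (real n) \<omega>)" using int1 by (simp add: increment_integral)
    from Bochner_Integration.integrable_add[OF this Suc] show ?case by (simp add: add.commute)
  qed
  define n where "n = nat \<lceil>t\<rceil>"
  have n: "t \<le> real n" unfolding n_def by linarith
  have [measurable]: "random_variable borel (X t)" "random_variable borel (X (real n))"
    using t by (auto intro: rv)
  have "moment (law (real n)) 1 < \<infinity>"
    using nat[of n] by (simp add: moment_law integrable_iff_bounded)
  moreover have "law (real n) = (law (real n - t) \<star> law t)" using semigroup[of "real n - t" t] n t by simp
  ultimately have "moment (law (real n - t) \<star> law t) 1 < \<infinity>" by (simp only:)
  then have "moment (law t) 1 < \<infinity>"
    by (rule moment_one_convolution_finite[rotated 2]) (use n t in \<open>auto intro!: law_distribution simp del: real_distribution_distr\<close>)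
  then show ?thesis using t by (simp add: moment_law integrable_iff_bounded)
qed

text \<open>
  The defect $d(t) = E X_t - t E X_1$ is additive and vanishes at rational times. Choose $h \<down> 0$ with $t + h$ rational;
  then $d(h) = -d(t)$, so that $X_h - E X_h$ tends to $d(t)$ almost surely, whereas its $p$-th moment tends to $0$.
  Fatou's lemma gives $d(t) = 0$.
\<close>
lemma expectation_linear:
  assumes semi: "char_semigroup law \<psi>" and int1: "integrable M (X 1)" and p: "0 < p"
    and small: "\<And>h. 0 \<le> h \<Longrightarrow> h \<le> 1 \<Longrightarrow>
      (\<integral>\<^sup>+\<omega>. ennreal (\<bar>X h \<omega> - expectation (X h)\<bar> powr p) \<partial>M) \<le> ennreal (C * h)"
    and t: "0 \<le> t"
  shows "expectation (X t) = t * expectation (X 1)"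
proof -
  note int = integrable_all_times[OF semi int1]
  define d where "d s = expectation (X s) - s * expectation (X 1)" for s
  have add: "d (r + s) = d r + d s" if rs: "0 \<le> r" "0 \<le> s" for r s
  proof -
    have "expectation (X (r + s)) - expectation (X r) = expectation (X s)"
      using increment_integral(2)[OF rs] int[of "r + s"] int[of r] rs by simp
    then show ?thesis by (simp add: d_def algebra_simps)
  qed
  have d0: "d 0 = 0" using add[of 0 0] by simp
  have mult: "d (real n * s) = real n * d s" if s: "0 \<le> s" for n s
  proof (induction n)
    case (Suc n)
    have "d (real (Suc n) * s) = d (s + real n * s)" by (simp add: algebra_simps)
    also have "\<dots> = real (Suc n) * d s" using Suc s by (simp add: add algebra_simps)
    finally show ?case .
  qed (simp add: d0)
  have d1: "d 1 = 0" by (simp add: d_def)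
  have rat: "d (real m / real (Suc k)) = 0" for m k
  proof -
    have "real (Suc k) * d (real m / real (Suc k)) = d (real m)"
      by (subst mult[symmetric]) auto
    also have "\<dots> = 0" using mult[of 1 m] d1 by simp
    finally show ?thesis by simp
  qed
  \<comment> \<open>$t + h_k$ is the least multiple of $1/(k+1)$ that exceeds $t$ strictly, as the limit at $0$ is taken from the right.\<close>
  define m where "m k = Suc (nat \<lfloor>t * real (Suc k)\<rfloor>)" for k
  define h where "h k = real (m k) / real (Suc k) - t" for k
  have h: "0 < h k" "h k \<le> 1 / real (Suc k)" for k
  proof -
    have fl: "0 \<le> \<lfloor>t * real (Suc k)\<rfloor>" using t by simp
    have "real (m k) = of_int \<lfloor>t * real (Suc k)\<rfloor> + 1" unfolding m_def using of_nat_nat[OF fl] by simp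
    then have m: "t * real (Suc k) < real (m k)" "real (m k) \<le> t * real (Suc k) + 1"
      using floor_correct[of "t * real (Suc k)"] by linarith+
    show "0 < h k" using m(1) by (simp add: h_def pos_less_divide_eq)
    have "real (m k) / real (Suc k) \<le> (t * real (Suc k) + 1) / real (Suc k)"
      using m(2) by (rule divide_right_mono) simp
    then show "h k \<le> 1 / real (Suc k)" by (simp add: h_def add_divide_distrib)
  qed
  have dh: "d (h k) = - d t" for k
    using add[of "h k" t] h(1)[of k] t rat[of "m k" k] by (simp add: h_def)
  have h1: "h k \<le> 1" for k
    using h(2)[of k] by (rule order_trans) simp
  have h_lim: "h \<longlonglongrightarrow> 0"
    by (rule tendsto_sandwich[of "\<lambda>_. 0" h sequentially "\<lambda>k. 1 / real (Suc k)"])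
      (use h LIMSEQ_Suc[OF lim_1_over_n] in \<open>auto intro!: always_eventually less_imp_le\<close>)
  have h_right: "filterlim h (at_right 0) sequentially"
    using h_lim h(1) by (auto simp: filterlim_at intro!: always_eventually less_imp_neq[symmetric])
  have e: "expectation (X (h k)) = h k * expectation (X 1) - d t" for k
    using dh[of k] by (simp add: d_def)
  define f where "f k \<omega> = ennreal (\<bar>X (h k) \<omega> - expectation (X (h k))\<bar> powr p)" for k \<omega>
  have f_rv: "f k \<in> borel_measurable M" for k
  proof -
    have [measurable]: "random_variable borel (X (h k))" using h(1)[of k] by (intro rv) simp
    show ?thesis unfolding f_def[abs_def] by measurable
  qed
  have "ennreal (\<bar>d t\<bar> powr p) = (\<integral>\<^sup>+\<omega>. ennreal (\<bar>d t\<bar> powr p) \<partial>M)" by (simp add: emeasure_space_1)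
  also have "\<dots> \<le> (\<integral>\<^sup>+\<omega>. liminf (\<lambda>k. f k \<omega>) \<partial>M)"
  proof (rule nn_integral_mono_AE)
    show "AE \<omega> in M. ennreal (\<bar>d t\<bar> powr p) \<le> liminf (\<lambda>k. f k \<omega>)"
      using cadlag_paths start_zero
    proof eventually_elim
      fix \<omega> assume c: "cadlag (\<lambda>t. X t \<omega>)" and X0: "X 0 \<omega> = 0"
      have "((\<lambda>t. X t \<omega>) \<longlongrightarrow> 0) (at_right 0)" using c X0 by (auto simp: cadlag_def)
      then have "(\<lambda>k. X (h k) \<omega>) \<longlonglongrightarrow> 0" using h_right by (rule filterlim_compose)
      then have "(\<lambda>k. f k \<omega>) \<longlonglongrightarrow> ennreal (\<bar>0 - (0 * expectation (X 1) - d t)\<bar> powr p)"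
        unfolding f_def e using h_lim p by (intro tendsto_ennrealI tendsto_powr' tendsto_intros) auto
      from lim_imp_Liminf[OF sequentially_bot this]
      show "ennreal (\<bar>d t\<bar> powr p) \<le> liminf (\<lambda>k. f k \<omega>)" by simp
    qed
  qed
  also have "\<dots> \<le> liminf (\<lambda>k. \<integral>\<^sup>+\<omega>. f k \<omega> \<partial>M)" using f_rv by (rule nn_integral_liminf)
  also have "\<dots> \<le> liminf (\<lambda>k. ennreal (C * h k))"
    unfolding f_def using h h1 by (intro Liminf_mono always_eventually allI small) (auto intro: less_imp_le)
  also have "\<dots> = 0"
  proof -
    have "(\<lambda>k. ennreal (C * h k)) \<longlonglongrightarrow> ennreal (C * 0)" using h_lim by (intro tendsto_ennrealI tendsto_intros)
    from lim_imp_Liminf[OF sequentially_bot this] show ?thesis by simp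
  qed
  finally have "d t = 0" by simp
  then show ?thesis by (simp add: d_def)
qed

lemma centered_moment_law:
  assumes t: "0 \<le> t" and p: "1 \<le> p" and int: "integrable M (X t)"
  shows "(\<integral>\<^sup>+\<omega>. ennreal (\<bar>X t \<omega> - expectation (X t)\<bar> powr p) \<partial>M) \<le> moment (symmetrize (law t)) p"
proof -
  have [measurable]: "random_variable borel (X t)" using t by (rule rv)
  interpret law: real_distribution "law t" by (rule law_distribution[OF t])
  have "integrable (law t) (\<lambda>x. x)" using int by (simp add: integrable_distr_eq)
  from law.centered_moment_le_symmetrize[OF p this] show ?thesis
    by (simp add: integral_distr nn_integral_distr)
qed

lemma levy_char_semigroup:
  assumes "has_characteristics M X a s2 \<nu>"
  shows "char_semigroup law (levy_exponent a s2 \<nu>)"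
  unfolding char_semigroup_def using assms law_distribution by (simp add: has_characteristics_def)

lemma moment_levy_measure_of_law:
  assumes char: "has_characteristics M X a 0 \<nu>" and p: "0 < p" "p < 2"
    and int: "integrable M (\<lambda>\<omega>. \<bar>X 1 \<omega>\<bar> powr p)" and small: "small_jump_moment \<nu> p < \<infinity>"
  shows "moment \<nu> p < \<infinity>"
proof (rule moment_levy_measure_finite[OF p])
  show "levy_measure \<nu>" using char by (simp add: has_characteristics_def)
  show "real_distribution (law 1)" by (rule law_distribution) simp
  show "char (law 1) u = exp (- levy_exponent a 0 \<nu> u)" for u
    using char by (simp add: has_characteristics_def)
  show "moment (law 1) p < \<infinity>" using int by (simp add: moment_law integrable_iff_bounded)
qed fact

text \<open>
  The Fourier estimate below exponent two and the superadditivity argument from two onwards, brought to a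
  common form.
\<close>
lemma symmetrized_law_moment_bound:
  assumes char: "has_characteristics M X a 0 \<nu>" and p: "1 \<le> p"
    and int: "integrable M (\<lambda>\<omega>. \<bar>X 1 \<omega>\<bar> powr p)" and small: "p < 2 \<longrightarrow> small_jump_moment \<nu> p < \<infinity>"
  shows "\<exists>C\<ge>0. \<forall>t\<ge>0. t \<le> 1 \<or> p \<le> 2 \<longrightarrow> moment (symmetrize (law t)) p \<le> ennreal (C * t)"
proof -
  interpret char_semigroup law "levy_exponent a 0 \<nu>" by (rule levy_char_semigroup[OF char])
  show ?thesis
  proof (cases "p < 2")
    case True
    have \<nu>: "levy_measure \<nu>" using char by (simp add: has_characteristics_def)
    have "moment \<nu> p < \<infinity>" using True p by (intro moment_levy_measure_of_law[OF char _ _ int small[rule_format, OF True]]) auto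
    from moment_bound_of_symmetrized_char[OF _ True \<nu> this, of a] p show ?thesis
      using char_symmetrize_exp symmetrize_distribution by (auto simp del: of_real_exp)
  next
    case False
    interpret law1: real_distribution "law 1" by (rule law_distribution) simp
    have "moment (law 1) p < \<infinity>" using int by (simp add: moment_law integrable_iff_bounded)
    then have "moment (symmetrize (law 1)) p < \<infinity>" using p by (intro law1.moment_symmetrize_finite) auto
    then obtain C where "0 \<le> C"
      "\<And>t. 0 \<le> t \<Longrightarrow> t \<le> 1 \<or> p = 2 \<Longrightarrow> moment (symmetrize (law t)) p \<le> ennreal (C * t)"
      using symmetrized_moment_bound_ge_two[of p] False by auto
    with False show ?thesis by (intro exI[of _ C]) auto
  qed
qed

text \<open>
  The maximal inequality for $p > 1$ refers to the final time $t$ only; for $p = 1$, where Doob's inequality fails,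
  the increments are summed instead, and the number of cells times $C h$ is $C t$.
\<close>
lemma centered_grid_bound:
  assumes char: "has_characteristics M X a 0 \<nu>" and p: "1 \<le> p"
    and int: "integrable M (\<lambda>\<omega>. \<bar>X 1 \<omega>\<bar> powr p)" and small: "p < 2 \<longrightarrow> small_jump_moment \<nu> p < \<infinity>"
  shows "\<exists>C\<ge>0. \<forall>t>0. t \<le> 1 \<or> p \<le> 2 \<longrightarrow> (\<forall>n.
    (\<integral>\<^sup>+\<omega>. grid_sup (expectation (X 1)) p (t / 2^n) (2^n) \<omega> \<partial>M) \<le> ennreal (C * t))"
proof -
  define e where "e = expectation (X 1)"
  note semi = levy_char_semigroup[OF char]
  have int1: "integrable M (X 1)" using integrable_of_powr[OF p rv[of 1] int] by simp
  note int_all = integrable_all_times[OF semi int1]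
  obtain C where C: "0 \<le> C"
    "\<And>t. 0 \<le> t \<Longrightarrow> t \<le> 1 \<or> p \<le> 2 \<Longrightarrow> moment (symmetrize (law t)) p \<le> ennreal (C * t)"
    using symmetrized_law_moment_bound[OF char p int small] by blast
  have bound: "(\<integral>\<^sup>+\<omega>. ennreal (\<bar>X t \<omega> - expectation (X t)\<bar> powr p) \<partial>M) \<le> ennreal (C * t)"
    if "0 \<le> t" "t \<le> 1 \<or> p \<le> 2" for t
    using centered_moment_law[OF that(1) p int_all[OF that(1)]] C(2)[OF that] by (rule order_trans)
  have mean: "expectation (X t) = t * e" if "0 \<le> t" for t
    unfolding e_def using p bound that by (intro expectation_linear[OF semi int1, of p C]) auto
  define K where "K = (if p = 1 then 1 else (2 * p / (p - 1)) powr p)"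
  have "(\<integral>\<^sup>+\<omega>. grid_sup e p (t / 2^n) (2^n) \<omega> \<partial>M) \<le> ennreal (K * C * t)"
    if t: "0 < t" "t \<le> 1 \<or> p \<le> 2" for t n
  proof -
    define h where "h = t / 2^n"
    have "h \<le> t" using t by (simp add: h_def divide_le_eq mult_le_cancel_left1)
    then have "h \<le> 1 \<or> p \<le> 2" using t by linarith
    moreover have "0 < h" "2^n * h = t" using t by (auto simp: h_def)
    ultimately have h: "0 < h" "h \<le> 1 \<or> p \<le> 2" "2^n * h = t" by auto
    have b: "(\<integral>\<^sup>+\<omega>. ennreal (\<bar>X h \<omega> - h * e\<bar> powr p) \<partial>M) \<le> ennreal (C * h)"
      using bound[of h] h mean[of h] by simp
    show ?thesis
    proof (cases "p = 1")
      case True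
      have "(\<integral>\<^sup>+\<omega>. grid_sup e p h (2^n) \<omega> \<partial>M) \<le> of_nat (2^n) * ennreal (C * h)"
        using grid_sup_moment_le_sum[of h p e "2^n"] mult_left_mono[OF b] h True
        by (intro order_trans[OF grid_sup_moment_le_sum]) auto
      also have "\<dots> = ennreal (real (2^n) * (C * h))"
        unfolding ennreal_of_nat_eq_real_of_nat using C h by (subst ennreal_mult) auto
      also have "real (2^n) * (C * h) = K * C * t" using h(3)[symmetric] True by (simp add: K_def)
      finally show ?thesis by (simp add: h_def)
    next
      case False
      have "(\<integral>\<^sup>+\<omega>. grid_sup e p h (2^n) \<omega> \<partial>M) \<le> ennreal K *
          (\<integral>\<^sup>+\<omega>. ennreal (\<bar>X (real (2^n) * h) \<omega> - real (2^n) * h * e\<bar> powr p) \<partial>M)"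
        using grid_sup_moment_le_doob[of h p e "2^n"] h p False mean[of h] b by (simp add: K_def le_less_trans)
      also have "\<dots> \<le> ennreal K * ennreal (C * t)"
        using bound[of t] mean[of t] t h(3) by (intro mult_left_mono) auto
      also have "\<dots> = ennreal (K * C * t)" by (simp add: ennreal_mult'[symmetric] K_def mult.assoc)
      finally show ?thesis by (simp add: h_def)
    qed
  qed
  moreover have "0 \<le> K * C" using C by (simp add: K_def)
  ultimately show ?thesis unfolding e_def by (intro exI[of _ "K * C"]) auto
qed

lemma centered_sup_moment_bound:
  assumes char: "has_characteristics M X a 0 \<nu>" and p: "1 \<le> p" "p \<le> 2"
    and int: "integrable M (\<lambda>\<omega>. \<bar>X 1 \<omega>\<bar> powr p)" and small: "small_jump_moment \<nu> p < \<infinity>"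
  shows "\<exists>C\<ge>0. \<forall>t\<ge>0. sup_moment M (\<lambda>s \<omega>. X s \<omega> - s * expectation (X 1)) p t \<le> ennreal (C * t)"
proof -
  obtain C where C: "0 \<le> C" "\<And>t n. 0 < t \<Longrightarrow>
      (\<integral>\<^sup>+\<omega>. grid_sup (expectation (X 1)) p (t / 2^n) (2^n) \<omega> \<partial>M) \<le> ennreal (C * t)"
    using centered_grid_bound[OF char p(1) int] small p by blast
  have "sup_moment M (\<lambda>s \<omega>. X s \<omega> - s * expectation (X 1)) p t \<le> ennreal (C * t)" if "0 \<le> t" for t
    using that p C sup_moment_le_grid[of t p] by (cases "t = 0") (auto simp: sup_moment_zero)
  with C show ?thesis by blast
qed

text \<open>
  Each of the $2^n$ increments over a cell of length $t/2^n$ contributes $C t/2^n$, which adds up to $C t$ for every $n$.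
\<close>
lemma driftless_sup_moment_bound:
  assumes char: "has_characteristics M X a 0 \<nu>" and p: "0 < p" "p < 1"
    and int: "integrable M (\<lambda>\<omega>. \<bar>X 1 \<omega>\<bar> powr p)" and small: "small_jump_moment \<nu> p < \<infinity>"
  defines "b \<equiv> a - (LINT x:{x. \<bar>x\<bar> \<le> 1}|\<nu>. x)"
  shows "\<exists>C\<ge>0. \<forall>t\<ge>0. sup_moment M (\<lambda>s \<omega>. X s \<omega> - s * b) p t \<le> ennreal (C * t)"
proof -
  have \<nu>: "levy_measure \<nu>" using char by (simp add: has_characteristics_def)
  have m: "moment \<nu> p < \<infinity>" using p by (intro moment_levy_measure_of_law[OF char _ _ int small]) auto
  obtain C where C: "0 \<le> C" "\<And>t \<mu>. 0 \<le> t \<Longrightarrow> real_distribution \<mu> \<Longrightarrow>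
      (\<And>u. char \<mu> u = exp (- of_real t * (levy_exponent a 0 \<nu> u + \<i> * of_real (u * b)))) \<Longrightarrow>
      moment \<mu> p \<le> ennreal (C * t)"
    using moment_bound_of_driftless_char[OF p \<nu> m, of a] unfolding b_def by blast
  have bound: "(\<integral>\<^sup>+\<omega>. ennreal (\<bar>X h \<omega> - h * b\<bar> powr p) \<partial>M) \<le> ennreal (C * h)" if h: "0 \<le> h" for h
  proof -
    have [measurable]: "random_variable borel (X h)" using h by (rule rv)
    have "moment (distr M borel (\<lambda>\<omega>. X h \<omega> - h * b)) p \<le> ennreal (C * h)"
    proof (rule C(2)[OF h])
      fix u
      have "char (distr M borel (\<lambda>\<omega>. X h \<omega> - h * b)) u = (CLINT \<omega>|M. iexp (u * X h \<omega>) * iexp (- u * h * b))"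
        unfolding char_def by (subst integral_distr) (auto simp: exp_add[symmetric] algebra_simps)
      also have "\<dots> = char (law h) u * iexp (- u * h * b)"
        unfolding char_def by (simp add: integral_distr)
      also have "\<dots> = exp (- of_real h * levy_exponent a 0 \<nu> u) * iexp (- u * h * b)"
        using char h by (simp add: has_characteristics_def)
      also have "\<dots> = exp (- of_real h * (levy_exponent a 0 \<nu> u + \<i> * of_real (u * b)))"
        by (simp add: exp_add[symmetric] algebra_simps)
      finally show "char (distr M borel (\<lambda>\<omega>. X h \<omega> - h * b)) u = \<dots>" .
    qed simp
    then show ?thesis unfolding moment_def by (simp add: nn_integral_distr)
  qed
  have "sup_moment M (\<lambda>s \<omega>. X s \<omega> - s * b) p t \<le> ennreal (C * t)" if t: "0 \<le> t" for t
  proof (cases "t = 0")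
    case False
    then have t: "0 < t" using t by simp
    show ?thesis
    proof (rule sup_moment_le_grid[OF t p(1)])
      fix n :: nat
      define h where "h = t / 2^n"
      have h: "0 \<le> h" "2^n * h = t" using t by (auto simp: h_def)
      have "(\<integral>\<^sup>+\<omega>. grid_sup b p h (2^n) \<omega> \<partial>M) \<le> of_nat (2^n) * (\<integral>\<^sup>+\<omega>. ennreal (\<bar>X h \<omega> - h * b\<bar> powr p) \<partial>M)"
        using h p by (intro grid_sup_moment_le_sum) auto
      also have "\<dots> \<le> of_nat (2^n) * ennreal (C * h)" using bound[OF h(1)] by (rule mult_left_mono) simp
      also have "\<dots> = ennreal (real (2^n) * (C * h))"
        unfolding ennreal_of_nat_eq_real_of_nat using C h by (subst ennreal_mult) auto
      also have "real (2^n) * (C * h) = C * t" using h(2)[symmetric] by simp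
      finally show "(\<integral>\<^sup>+\<omega>. grid_sup b p (t / 2^n) (2^n) \<omega> \<partial>M) \<le> ennreal (C * t)" by (simp add: h_def)
    qed
  qed (simp add: sup_moment_zero)
  with C(1) show ?thesis by blast
qed

text \<open>
  The drift $s E X_1$ is at most $t |E X_1|$, and $t^p \<le> t$ for $t \<le> 1$; the centred part is $O(t)$ by the Doob
  bound.
\<close>
lemma sup_moment_bound_small_time:
  assumes char: "has_characteristics M X a 0 \<nu>" and p: "2 < p"
    and int: "integrable M (\<lambda>\<omega>. \<bar>X 1 \<omega>\<bar> powr p)"
  shows "\<exists>C\<ge>0. \<forall>t>0. t \<le> 1 \<longrightarrow> sup_moment M X p t \<le> ennreal (C * t)"
proof -
  define e where "e = expectation (X 1)"
  obtain C where C: "0 \<le> C" "\<And>t n. 0 < t \<Longrightarrow> t \<le> 1 \<Longrightarrow>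
      (\<integral>\<^sup>+\<omega>. grid_sup e p (t / 2^n) (2^n) \<omega> \<partial>M) \<le> ennreal (C * t)"
    using centered_grid_bound[OF char _ int] p unfolding e_def by auto
  define K where "K = 2 powr p * (C + \<bar>e\<bar> powr p)"
  have "sup_moment M X p t \<le> ennreal (K * t)" if t: "0 < t" "t \<le> 1" for t
  proof -
    have "sup_moment M (\<lambda>s \<omega>. X s \<omega> - s * 0) p t \<le> ennreal (K * t)"
    proof (rule sup_moment_le_grid[OF t(1)])
      fix n :: nat
      define h where "h = t / 2^n"
      have h: "0 \<le> h" "2^n * h = t" using t by (auto simp: h_def)
      have [measurable]: "grid_sup e p h (2^n) \<in> borel_measurable M" using h(1) by (rule measurable_grid_sup)
      have "grid_sup 0 p h (2^n) \<omega> \<le> ennreal (2 powr p) * (grid_sup e p h (2^n) \<omega> + ennreal ((t * \<bar>e\<bar>) powr p))" for \<omega>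
        unfolding grid_sup_def[of 0]
      proof (rule SUP_least)
        fix k :: nat assume k: "k \<in> {..2^n}"
        then have "real k \<le> 2^n" by (simp flip: of_nat_le_iff)
        then have kh: "real k * h \<le> t" using h mult_right_mono[of "real k" "2^n" h] by simp
        have "\<bar>X (real k * h) \<omega> - real k * h * 0\<bar> powr p
            \<le> 2 powr p * (\<bar>X (real k * h) \<omega> - real k * h * e\<bar> powr p + \<bar>real k * h * e\<bar> powr p)"
          using powr_add_le[of p "X (real k * h) \<omega> - real k * h * e" "real k * h * e"] p by simp
        also have "\<dots> \<le> 2 powr p * (\<bar>X (real k * h) \<omega> - real k * h * e\<bar> powr p + (t * \<bar>e\<bar>) powr p)"
          using kh h p by (intro mult_left_mono add_left_mono powr_mono2) (auto simp: abs_mult intro!: mult_right_mono)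
        finally have "ennreal (\<bar>X (real k * h) \<omega> - real k * h * 0\<bar> powr p)
            \<le> ennreal (2 powr p) * (ennreal (\<bar>X (real k * h) \<omega> - real k * h * e\<bar> powr p) + ennreal ((t * \<bar>e\<bar>) powr p))"
          by (simp add: ennreal_mult[symmetric] ennreal_leI flip: ennreal_plus)
        also have "\<dots> \<le> ennreal (2 powr p) * (grid_sup e p h (2^n) \<omega> + ennreal ((t * \<bar>e\<bar>) powr p))"
          unfolding grid_sup_def using k by (intro mult_left_mono add_right_mono SUP_upper) auto
        finally show "ennreal (\<bar>X (real k * h) \<omega> - real k * h * 0\<bar> powr p)
          \<le> ennreal (2 powr p) * (grid_sup e p h (2^n) \<omega> + ennreal ((t * \<bar>e\<bar>) powr p))" .
      qed
      then have "(\<integral>\<^sup>+\<omega>. grid_sup 0 p h (2^n) \<omega> \<partial>M)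
          \<le> (\<integral>\<^sup>+\<omega>. ennreal (2 powr p) * (grid_sup e p h (2^n) \<omega> + ennreal ((t * \<bar>e\<bar>) powr p)) \<partial>M)"
        by (intro nn_integral_mono)
      also have "\<dots> = ennreal (2 powr p) * ((\<integral>\<^sup>+\<omega>. grid_sup e p h (2^n) \<omega> \<partial>M) + ennreal ((t * \<bar>e\<bar>) powr p))"
        by (simp add: nn_integral_cmult nn_integral_add emeasure_space_1)
      also have "\<dots> \<le> ennreal (2 powr p) * (ennreal (C * t) + ennreal (\<bar>e\<bar> powr p * t))"
      proof (intro mult_left_mono add_mono ennreal_leI)
        show "(\<integral>\<^sup>+\<omega>. grid_sup e p h (2^n) \<omega> \<partial>M) \<le> ennreal (C * t)" unfolding h_def using t by (rule C(2))
        have "t powr p \<le> t powr 1" using t p by (intro powr_mono') auto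
        then show "(t * \<bar>e\<bar>) powr p \<le> \<bar>e\<bar> powr p * t"
          using t by (simp add: powr_mult mult.commute[of _ t] mult_right_mono)
      qed simp
      also have "\<dots> = ennreal (K * t)"
        using C(1) t by (simp add: K_def ennreal_mult[symmetric] algebra_simps flip: ennreal_plus)
      finally show "(\<integral>\<^sup>+\<omega>. grid_sup 0 p (t / 2^n) (2^n) \<omega> \<partial>M) \<le> ennreal (K * t)" by (simp add: h_def)
    qed (use p in simp)
    then show ?thesis by simp
  qed
  moreover have "0 \<le> K" using C by (simp add: K_def)
  ultimately show ?thesis by blast
qed

end

theorem theorem1:
  fixes M :: "'a measure" and X :: "real \<Rightarrow> 'a \<Rightarrow> real"
    and a p :: real and \<nu> :: "real measure"
  assumes "levy_process M X"
    and "has_characteristics M X a 0 \<nu>"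
    and "0 < p"
    and "integrable M (\<lambda>\<omega>. \<bar>X 1 \<omega>\<bar> powr p)"
    and "levy_index \<nu> < p \<or>
         (p = levy_index \<nu> \<and> 0 < levy_index \<nu> \<and> small_jump_moment \<nu> (levy_index \<nu>) < \<infinity>)"
  shows "(\<exists>C::real. 0 \<le> C \<and> (\<forall>t\<ge>0.
            (p < 1 \<longrightarrow>
               sup_moment M (\<lambda>s \<omega>. X s \<omega> - s * (a - (LINT x:{x. \<bar>x\<bar> \<le> 1}|\<nu>. x))) p t
                 \<le> ennreal (C * t)) \<and>
            (1 \<le> p \<and> p \<le> 2 \<longrightarrow>
               sup_moment M (\<lambda>s \<omega>. X s \<omega> - s * (LINT \<omega>'|M. X 1 \<omega>')) p t
                 \<le> ennreal (C * t)))) \<and>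
         (2 < p \<longrightarrow>
            (\<forall>\<^sub>F t in at_right 0. sup_moment M X p t < \<infinity>) \<and>
            (\<lambda>t. enn2real (sup_moment M X p t)) \<in> O[at_right 0](\<lambda>t. t))"
proof -
  interpret levy_process M X by fact
  note char = assms(2) and p0 = assms(3) and int = assms(4)
  have small: "small_jump_moment \<nu> p < \<infinity>"
    using char assms(5) by (intro small_jump_moment_finite) (auto simp: has_characteristics_def)
  have le2: "\<exists>C::real. 0 \<le> C \<and> (\<forall>t\<ge>0.
            (p < 1 \<longrightarrow>
               sup_moment M (\<lambda>s \<omega>. X s \<omega> - s * (a - (LINT x:{x. \<bar>x\<bar> \<le> 1}|\<nu>. x))) p t
                 \<le> ennreal (C * t)) \<and>
            (1 \<le> p \<and> p \<le> 2 \<longrightarrow>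
               sup_moment M (\<lambda>s \<omega>. X s \<omega> - s * (LINT \<omega>'|M. X 1 \<omega>')) p t
                 \<le> ennreal (C * t)))"
  proof -
    consider "p < 1" | "1 \<le> p" "p \<le> 2" | "2 < p" by linarith
    then show ?thesis
    proof cases
      case 1
      then show ?thesis using driftless_sup_moment_bound[OF char p0 1 int small] by auto
    next
      case 2
      then show ?thesis using centered_sup_moment_bound[OF char 2 int small] by auto
    qed (auto intro: exI[of _ 0])
  qed
  have gt2: "(\<forall>\<^sub>F t in at_right 0. sup_moment M X p t < \<infinity>) \<and>
            (\<lambda>t. enn2real (sup_moment M X p t)) \<in> O[at_right 0](\<lambda>t. t)" if gt: "2 < p"
  proof -
    obtain C where C: "0 \<le> C" "\<And>t. 0 < t \<Longrightarrow> t \<le> 1 \<Longrightarrow> sup_moment M X p t \<le> ennreal (C * t)"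
      using sup_moment_bound_small_time[OF char gt int] by blast
    have ev: "\<forall>\<^sub>F t in at_right 0. 0 < t \<and> t \<le> (1::real)"
      by (auto simp: eventually_at_right_field intro!: exI[of _ 1])
    have "\<forall>\<^sub>F t in at_right 0. sup_moment M X p t < \<infinity>"
      using ev
    proof eventually_elim
      fix t :: real assume "0 < t \<and> t \<le> 1"
      then show "sup_moment M X p t < \<infinity>" using le_less_trans[OF C(2)[of t]] by simp
    qed
    moreover have "(\<lambda>t. enn2real (sup_moment M X p t)) \<in> O[at_right 0](\<lambda>t. t)"
    proof (rule bigoI)
      show "\<forall>\<^sub>F t in at_right 0. norm (enn2real (sup_moment M X p t)) \<le> C * norm t"
        using ev
      proof eventually_elim
        fix t :: real assume "0 < t \<and> t \<le> 1"
        then show "norm (enn2real (sup_moment M X p t)) \<le> C * norm t"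
          using C enn2real_mono[OF C(2)[of t]] by simp
      qed
    qed
    ultimately show ?thesis by blast
  qed
  from le2 gt2 show ?thesis by blast
qed

end
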